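(* Let $T\ge2$, $\mathcal{T}=\{1,\dots,T\}$, and consider the special model described in the context. For each $i\in\mathcal{T}$ with $i\ge2$, writing $g=\prod_{s=T-i+1}^{T-1}f_s$, $$\operatorname{E}\bigg[\frac{(C^{\alpha}_{i,T}-C^{\alpha}_{i,T-i+1}g)^2}{C^{\alpha}_{i,T-i+1}}\,\Big|\,\mathcal{D}^{\alpha}\bigg]=\frac{\alpha}{C^{\alpha}_{i,T-i+1}}\bigg(\frac{\operatorname{E}[M^{\alpha}_i]}{\alpha}\operatorname{E}[Z^2]\,\mathbb{P}(D>T-i+1)+(H^{\alpha})^2(g-1)^2\bigg),$$ and, as $\alpha\to\infty$, this converges in distribution to $$\frac{\operatorname{E}[Z^2]}{\operatorname{E}[Z]}\Big((g-1)+(g-1)^2\chi^2_1\Big),$$ where $$(H^{\alpha})^2=\frac{(C^{\alpha}_{i,T-i+1}-\operatorname{E}[C^{\alpha}_{i,T-i+1}])^2}{\alpha}\xrightarrow{d}\lambda_i\operatorname{E}[Z^2]\,\mathbb{P}(D\le T-i+1)\chi^2_1=:H^2,$$ and $\chi^2_1$ has a chi-squared distribution with one degree of freedom. In particular, the expectation of the limit variable equals $$\frac{\lambda_i\operatorname{E}[Z^2]\mathbb{P}(D>T-i+1)+\operatorname{E}[H^2](g-1)^2}{\lambda_i\operatorname{E}[Z]\mathbb{P}(D\le T-i+1)}=\sum_{t=T-i+1}^{T-1}f_{T-i+1}\cdots f_{t-1}\,\sigma^2_t\,f_{t+1}^2\cdots f_{T-1}^2.$$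
   Context: Special model. Fix an integer $T\ge2$, $\mathcal{T}=\{1,\dots,T\}$. For each $i\in\mathcal{T}$, $(M^{\alpha}_i)_{\alpha\ge0}$ is a homogeneous Poisson process with intensity $\lambda_i\in(0,\infty)$, and $(D_{i,k},Z_{i,k})_{k\ge1}$ is an i.i.d. sequence of pairs with $D_{i,k}\in\mathcal{T}$, whose common distribution is that of a generic pair $(D,Z)$ not depending on $i$, where $D$ and $Z$ are independent, $\operatorname{E}[Z^2]<\infty$ and $\operatorname{E}[ZI\{D=t\}]>0$ for all $t\in\mathcal{T}$. For each $i$, $(D_{i,k},Z_{i,k})_{k}$ is independent of $(M^\alpha_i)_\alpha$, and the families $\{(M^{\alpha}_i)_\alpha,(D_{i,k},Z_{i,k})_k\}$, $i=1,\dots,T$, are independent. Define $C^{\alpha}_{i,t}=\sum_{k=1}^{M^{\alpha}_i}Z_{i,k}I\{D_{i,k}\le t\}$. Let $\mathcal{D}^{\alpha}$ be the $\sigma$-algebra generated by $\{C^{\alpha}_{j,t}:j,t\in\mathcal{T},\ j+t\le T+1\}$. For $t\le T-1$, $f_t=\operatorname{E}[ZI\{D\le t+1\}]/\operatorname{E}[ZI\{D\le t\}]$ and $$\sigma^2_t=(f_t-1)\bigg(\frac{\operatorname{E}[Z^2I\{D=t+1\}]}{\operatorname{E}[ZI\{D=t+1\}]}+(f_t-1)\frac{\operatorname{E}[Z^2I\{D\le t\}]}{\operatorname{E}[ZI\{D\le t\}]}\bigg).$$ *)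

theory Defs
  imports "HOL-Probability.Probability"
begin

definition poisson_process :: "'a measure \<Rightarrow> (real \<Rightarrow> 'a \<Rightarrow> nat) \<Rightarrow> real \<Rightarrow> bool" where
  "poisson_process M N lam \<longleftrightarrow>
     (\<forall>a\<ge>0. N a \<in> measurable M (count_space UNIV)) \<and>
     (\<forall>\<omega>\<in>space M. N 0 \<omega> = 0) \<and>
     (\<forall>\<omega>\<in>space M. mono_on {0..} (\<lambda>a. N a \<omega>)) \<and>
     (\<forall>s t n. 0 \<le> s \<longrightarrow> s \<le> t \<longrightarrow>
        measure M {\<omega>\<in>space M. N t \<omega> - N s \<omega> = n}
          = (lam * (t - s)) ^ n / fact n * exp (- (lam * (t - s)))) \<and>
     (\<forall>(t :: nat \<Rightarrow> real) n. 0 \<le> t 0 \<longrightarrow> strict_mono t \<longrightarrow>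
        prob_space.indep_vars M (\<lambda>_. count_space UNIV)
          (\<lambda>j \<omega>. N (t (Suc j)) \<omega> - N (t j) \<omega>) {..<n})"

definition gen_sets :: "'a measure \<Rightarrow> 'b measure \<Rightarrow> ('a \<Rightarrow> 'b) set \<Rightarrow> 'a set set" where
  "gen_sets M N Xs = sigma_sets (space M) {X -` A \<inter> space M | X A. X \<in> Xs \<and> A \<in> sets N}"

definition cum :: "(nat \<Rightarrow> real \<Rightarrow> 'a \<Rightarrow> nat) \<Rightarrow> (nat \<Rightarrow> nat \<Rightarrow> 'a \<Rightarrow> nat) \<Rightarrow>
    (nat \<Rightarrow> nat \<Rightarrow> 'a \<Rightarrow> real) \<Rightarrow> nat \<Rightarrow> nat \<Rightarrow> real \<Rightarrow> 'a \<Rightarrow> real" where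
  "cum N Dl Zl i t a \<omega> = (\<Sum>k = 1..N i a \<omega>. Zl i k \<omega> * (if Dl i k \<omega> \<le> t then 1 else 0))"

definition triangle_alg :: "'a measure \<Rightarrow> nat \<Rightarrow> (nat \<Rightarrow> real \<Rightarrow> 'a \<Rightarrow> nat) \<Rightarrow>
    (nat \<Rightarrow> nat \<Rightarrow> 'a \<Rightarrow> nat) \<Rightarrow> (nat \<Rightarrow> nat \<Rightarrow> 'a \<Rightarrow> real) \<Rightarrow> real \<Rightarrow> 'a measure" where
  "triangle_alg M T N Dl Zl a = sigma (space M)
     {cum N Dl Zl j t a -` B \<inter> space M | j t B.
        j \<in> {1..T} \<and> t \<in> {1..T} \<and> j + t \<le> T + 1 \<and> B \<in> sets borel}"

definition dev_f :: "'a measure \<Rightarrow> ('a \<Rightarrow> nat) \<Rightarrow> ('a \<Rightarrow> real) \<Rightarrow> nat \<Rightarrow> real" where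
  "dev_f M D Z t = (LINT \<omega>|M. Z \<omega> * indicator {\<omega>. D \<omega> \<le> t + 1} \<omega>)
                 / (LINT \<omega>|M. Z \<omega> * indicator {\<omega>. D \<omega> \<le> t} \<omega>)"

definition dev_sigma2 :: "'a measure \<Rightarrow> ('a \<Rightarrow> nat) \<Rightarrow> ('a \<Rightarrow> real) \<Rightarrow> nat \<Rightarrow> real" where
  "dev_sigma2 M D Z t = (dev_f M D Z t - 1) *
     ((LINT \<omega>|M. (Z \<omega>)\<^sup>2 * indicator {\<omega>. D \<omega> = t + 1} \<omega>)
        / (LINT \<omega>|M. Z \<omega> * indicator {\<omega>. D \<omega> = t + 1} \<omega>)
      + (dev_f M D Z t - 1) *
        ((LINT \<omega>|M. (Z \<omega>)\<^sup>2 * indicator {\<omega>. D \<omega> \<le> t} \<omega>)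
          / (LINT \<omega>|M. Z \<omega> * indicator {\<omega>. D \<omega> \<le> t} \<omega>)))"

text \<open>Convergence in distribution as the real parameter tends to infinity:
  pointwise convergence of cdfs at continuity points of the limit cdf
  (the real-indexed analogue of weak_conv_m).\<close>
definition conv_distr_at_top :: "(real \<Rightarrow> real measure) \<Rightarrow> real measure \<Rightarrow> bool" where
  "conv_distr_at_top Ms L \<longleftrightarrow>
     (\<forall>x. isCont (cdf L) x \<longrightarrow> ((\<lambda>a. cdf (Ms a) x) \<longlongrightarrow> cdf L x) at_top)"

definition std_normal :: "real measure" where
  "std_normal = density lborel std_normal_density"

definition chi2_1 :: "real measure" where
  "chi2_1 = distr std_normal borel (\<lambda>x. x\<^sup>2)"

end

theory Submission
  imports Defs
begin

text \<open>Splitting a compound Poisson sum according to whether a claim is already reported yields two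
  independent sums: for a product of functions of the two parts, adding one claim gives a Pascal recursion
  in the number of claims, and the Poisson weights turn the resulting binomial convolution into a Cauchy product.
  Hence the outstanding part \<open>U\<close> of row \<open>i\<close> is independent of the observed triangle, and expanding
  \<open>(U - (g - 1) V)\<^sup>2\<close> with \<open>V\<close> observed gives the conditional expectation, because
  \<open>(g - 1) E[V] = E[U]\<close>. The standardized \<open>V\<close> is asymptotically normal by characteristic functions,
  and both statistics are continuously convergent functions of it. Independence of delay and amount gives
  \<open>f\<^sub>t = p\<^sub>t\<^sub>+\<^sub>1 / p\<^sub>t\<close> with \<open>p\<^sub>t = P(D \<le> t)\<close>, so the final sum telescopes.\<close>

section \<open>Independent pairs\<close>

text \<open>Claims may have any sign, so the denominator \<open>C a \<alpha>\<close> can be negative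
  or arbitrarily close to 0, and it is 0 whenever the row has no claim yet, an event of positive
  probability for each finite \<alpha>. The quotient need not be integrable, so the pull-out rule
  for integrable products does not apply to it; what rescues the factor
  \<open>1 / C a \<alpha>\<close> is that the numerator is a square. Where the denominator is 0 both
  sides are 0, because \<open>x / 0 = 0\<close>. The same denominator shapes the limit. In terms of
  the standardized variable the quotient is a map with a pole whose place depends on \<alpha>, so
  the continuous mapping theorem for one fixed map is not enough; the pole runs off to infinity, and
  continuous convergence of the maps is what remains true. Conditioning is on every entry of the
  triangle, so independence from the single entry V would be too weak: thinning is proved for the
  whole vector of observed entries of a row. Iterating operators on bounded test functions avoids
  describing the law of the claims given how many of them are reported.\<close>

text \<open>The library's \<open>indep_var\<close> requires both random variables to have the same value type.\<close>

definition (in prob_space) indep_pair ::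
    "'b measure \<Rightarrow> ('a \<Rightarrow> 'b) \<Rightarrow> 'c measure \<Rightarrow> ('a \<Rightarrow> 'c) \<Rightarrow> bool" where
  "indep_pair S X T Y \<longleftrightarrow> random_variable S X \<and> random_variable T Y \<and>
     distr M S X \<Otimes>\<^sub>M distr M T Y = distr M (S \<Otimes>\<^sub>M T) (\<lambda>\<omega>. (X \<omega>, Y \<omega>))"

lemma (in prob_space) indep_pair_rv:
  assumes "indep_pair S X T Y"
  shows indep_pair_rv1: "random_variable S X" and indep_pair_rv2: "random_variable T Y"
  using assms by (auto simp: indep_pair_def)

lemma (in prob_space) indep_var_iff_indep_pair: "indep_var S X T Y \<longleftrightarrow> indep_pair S X T Y"
  unfolding indep_pair_def indep_var_distribution_eq ..

text \<open>A product of probability measures is determined by its values on rectangles, so equality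
  of laws reduces to the product rule for events. Independence is established below in this
  form.\<close>

lemma (in prob_space) indep_pair_iff_prob:
  "indep_pair S X T Y \<longleftrightarrow> random_variable S X \<and> random_variable T Y \<and>
     (\<forall>A\<in>sets S. \<forall>B\<in>sets T. prob {\<omega> \<in> space M. X \<omega> \<in> A \<and> Y \<omega> \<in> B} =
        prob {\<omega> \<in> space M. X \<omega> \<in> A} * prob {\<omega> \<in> space M. Y \<omega> \<in> B})"
proof (cases "random_variable S X \<and> random_variable T Y")
  case True
  then have [measurable]: "random_variable S X" "random_variable T Y" by auto
  interpret X: prob_space "distr M S X" by (rule prob_space_distr) measurable
  interpret Y: prob_space "distr M T Y" by (rule prob_space_distr) measurable
  let ?J = "distr M (S \<Otimes>\<^sub>M T) (\<lambda>\<omega>. (X \<omega>, Y \<omega>))"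
  have J: "emeasure ?J (A \<times> B) = ennreal (prob {\<omega> \<in> space M. X \<omega> \<in> A \<and> Y \<omega> \<in> B})"
    if "A \<in> sets S" "B \<in> sets T" for A B
    using that by (subst emeasure_distr) (auto simp: emeasure_eq_measure intro!: arg_cong[where f=prob])
  have D: "emeasure (distr M S X) A * emeasure (distr M T Y) B =
      ennreal (prob {\<omega> \<in> space M. X \<omega> \<in> A} * prob {\<omega> \<in> space M. Y \<omega> \<in> B})"
    if "A \<in> sets S" "B \<in> sets T" for A B
    using that by (auto simp: emeasure_distr emeasure_eq_measure ennreal_mult'[symmetric] vimage_def Int_def conj_commute)
  have "distr M S X \<Otimes>\<^sub>M distr M T Y = ?J \<longleftrightarrow>
     (\<forall>A\<in>sets S. \<forall>B\<in>sets T. prob {\<omega> \<in> space M. X \<omega> \<in> A \<and> Y \<omega> \<in> B} =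
        prob {\<omega> \<in> space M. X \<omega> \<in> A} * prob {\<omega> \<in> space M. Y \<omega> \<in> B})" (is "?L \<longleftrightarrow> ?R")
  proof
    assume eq: ?L
    show ?R
    proof (intro ballI)
      fix A B assume AB: "A \<in> sets S" "B \<in> sets T"
      have "emeasure (distr M S X \<Otimes>\<^sub>M distr M T Y) (A \<times> B) = emeasure (distr M S X) A * emeasure (distr M T Y) B"
        using AB by (intro Y.emeasure_pair_measure_Times) auto
      then show "prob {\<omega> \<in> space M. X \<omega> \<in> A \<and> Y \<omega> \<in> B} =
          prob {\<omega> \<in> space M. X \<omega> \<in> A} * prob {\<omega> \<in> space M. Y \<omega> \<in> B}"
        unfolding eq D[OF AB] J[OF AB] by (simp add: measure_nonneg)
    qed
  next
    assume ?R
    show ?L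
    proof (rule pair_measure_eqI)
      fix A B assume "A \<in> sets (distr M S X)" "B \<in> sets (distr M T Y)"
      then have AB: "A \<in> sets S" "B \<in> sets T" by auto
      show "emeasure (distr M S X) A * emeasure (distr M T Y) B = emeasure ?J (A \<times> B)"
        unfolding J[OF AB] D[OF AB] using \<open>?R\<close> AB by auto
    qed (auto intro: X.sigma_finite_measure_axioms Y.sigma_finite_measure_axioms)
  qed
  then show ?thesis
    using True by (simp add: indep_pair_def)
qed (auto simp: indep_pair_def)

lemma (in prob_space) indep_pair_compose:
  assumes ind: "indep_pair S X T Y" and f: "f \<in> measurable S S'" and g: "g \<in> measurable T T'"
  shows "indep_pair S' (\<lambda>\<omega>. f (X \<omega>)) T' (\<lambda>\<omega>. g (Y \<omega>))"
  unfolding indep_pair_iff_prob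
proof (intro conjI ballI)
  have X: "random_variable S X" and Y: "random_variable T Y"
    using ind by (auto simp: indep_pair_def)
  then show "random_variable S' (\<lambda>\<omega>. f (X \<omega>))" "random_variable T' (\<lambda>\<omega>. g (Y \<omega>))"
    using f g by measurable
  fix A B assume "A \<in> sets S'" "B \<in> sets T'"
  then have *: "f -` A \<inter> space S \<in> sets S" "g -` B \<inter> space T \<in> sets T"
    using f g by (auto intro: measurable_sets)
  have sp: "\<omega> \<in> space M \<Longrightarrow> X \<omega> \<in> space S" "\<omega> \<in> space M \<Longrightarrow> Y \<omega> \<in> space T" for \<omega>
    using X Y by (auto dest: measurable_space)
  show "prob {\<omega> \<in> space M. f (X \<omega>) \<in> A \<and> g (Y \<omega>) \<in> B} =
      prob {\<omega> \<in> space M. f (X \<omega>) \<in> A} * prob {\<omega> \<in> space M. g (Y \<omega>) \<in> B}"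
    using ind[unfolded indep_pair_iff_prob, THEN conjunct2, THEN conjunct2, rule_format, OF *] sp
    by (simp cong: conj_cong)
qed

lemma (in prob_space) indep_pair_integral:
  fixes f :: "'b \<Rightarrow> 'd :: {real_normed_field, banach, second_countable_topology}"
  assumes ind: "indep_pair S X T Y"
    and [measurable]: "f \<in> borel_measurable S" "g \<in> borel_measurable T"
    and int: "integrable M (\<lambda>\<omega>. f (X \<omega>))" "integrable M (\<lambda>\<omega>. g (Y \<omega>))"
  shows indep_pair_integrable_mult: "integrable M (\<lambda>\<omega>. f (X \<omega>) * g (Y \<omega>))"
    and indep_pair_integral_mult: "(\<integral>\<omega>. f (X \<omega>) * g (Y \<omega>) \<partial>M) = (\<integral>\<omega>. f (X \<omega>) \<partial>M) * (\<integral>\<omega>. g (Y \<omega>) \<partial>M)"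
proof -
  have "indep_var borel (\<lambda>\<omega>. f (X \<omega>)) borel (\<lambda>\<omega>. g (Y \<omega>))"
    unfolding indep_var_iff_indep_pair by (rule indep_pair_compose[OF ind]) measurable
  from indep_var_integrable[OF this int] indep_var_lebesgue_integral[OF this int]
  show "integrable M (\<lambda>\<omega>. f (X \<omega>) * g (Y \<omega>))"
    "(\<integral>\<omega>. f (X \<omega>) * g (Y \<omega>) \<partial>M) = (\<integral>\<omega>. f (X \<omega>) \<partial>M) * (\<integral>\<omega>. g (Y \<omega>) \<partial>M)"
    by auto
qed

text \<open>Fubini for the product law: with X frozen, Y is averaged under its own law. It serves to
  integrate out the last mark of a sum.\<close>

lemma (in prob_space) indep_pair_integral_iterated:
  fixes f :: "'b \<times> 'c \<Rightarrow> 'd :: {banach, second_countable_topology}"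
  assumes ind: "indep_pair S X T Y"
    and f: "f \<in> borel_measurable (S \<Otimes>\<^sub>M T)"
    and int: "integrable M (\<lambda>\<omega>. f (X \<omega>, Y \<omega>))"
  shows "(\<integral>\<omega>. f (X \<omega>, Y \<omega>) \<partial>M) = (\<integral>\<omega>. (\<integral>y. f (X \<omega>, y) \<partial>distr M T Y) \<partial>M)"
proof -
  have [measurable]: "random_variable S X" "random_variable T Y"
    using ind by (auto dest: indep_pair_rv)
  have eq: "distr M S X \<Otimes>\<^sub>M distr M T Y = distr M (S \<Otimes>\<^sub>M T) (\<lambda>x. (X x, Y x))"
    using ind unfolding indep_pair_def by auto
  interpret X: prob_space "distr M S X" by (rule prob_space_distr) measurable
  interpret Y: prob_space "distr M T Y" by (rule prob_space_distr) measurable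
  interpret XY: pair_prob_space "distr M S X" "distr M T Y" ..
  note f[measurable]
  have "integrable (distr M S X \<Otimes>\<^sub>M distr M T Y) f"
    unfolding eq using int by (subst integrable_distr_eq) auto
  from XY.integral_fst'[OF this]
  have "(\<integral>x. \<integral>y. f (x, y) \<partial>distr M T Y \<partial>distr M S X) = (\<integral>z. f z \<partial>distr M (S \<Otimes>\<^sub>M T) (\<lambda>x. (X x, Y x)))"
    unfolding eq .
  moreover have "(\<lambda>x. \<integral>y. f (x, y) \<partial>distr M T Y) \<in> borel_measurable S"
    by measurable
  ultimately show ?thesis
    by (simp add: integral_distr)
qed

text \<open>\<open>F (N \<omega>) \<omega>\<close> is the sum over n of
  \<open>of_bool (N \<omega> = n) * F n \<omega>\<close>; independence factors each term, and
  summability of the absolute means justifies exchanging sum and expectation.\<close>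

lemma (in prob_space) random_index:
  fixes F :: "nat \<Rightarrow> 'a \<Rightarrow> 'b :: {real_normed_field, banach, second_countable_topology}"
  assumes ind: "\<And>n. indep_pair (count_space UNIV) N borel (F n)"
    and int: "\<And>n. integrable M (F n)"
    and sm: "summable (\<lambda>n. prob {\<omega> \<in> space M. N \<omega> = n} * expectation (\<lambda>\<omega>. norm (F n \<omega>)))"
  shows random_index_integrable: "integrable M (\<lambda>\<omega>. F (N \<omega>) \<omega>)"
    and random_index_sums: "(\<lambda>n. of_real (prob {\<omega> \<in> space M. N \<omega> = n}) * integral\<^sup>L M (F n)) sums (\<integral>\<omega>. F (N \<omega>) \<omega> \<partial>M)"
proof -
  have N[measurable]: "N \<in> measurable M (count_space UNIV)"
    using ind[of 0] by (rule indep_pair_rv1)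
  let ?f = "\<lambda>n \<omega>. of_bool (N \<omega> = n) * F n \<omega>"
  have F[measurable]: "F n \<in> borel_measurable M" for n using int[of n] by auto
  have ev: "integral\<^sup>L M (\<lambda>\<omega>. of_bool (N \<omega> = n) :: real) = prob {\<omega> \<in> space M. N \<omega> = n}" for n
  proof -
    have "integral\<^sup>L M (\<lambda>\<omega>. of_bool (N \<omega> = n) :: real) = integral\<^sup>L M (indicator {\<omega> \<in> space M. N \<omega> = n})"
      by (intro Bochner_Integration.integral_cong) (auto simp: indicator_def)
    then show ?thesis by simp
  qed
  have intr: "integrable M (\<lambda>\<omega>. of_bool (N \<omega> = n) :: real)" and intb: "integrable M (\<lambda>\<omega>. of_bool (N \<omega> = n) :: 'b)" for n
    by (rule integrable_const_bound[where B=1]; auto)+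
  have ev': "integral\<^sup>L M (\<lambda>\<omega>. of_bool (N \<omega> = n) :: 'b) = of_real (prob {\<omega> \<in> space M. N \<omega> = n})" for n
  proof -
    have "integral\<^sup>L M (\<lambda>\<omega>. of_bool (N \<omega> = n) :: 'b) = integral\<^sup>L M (\<lambda>\<omega>. of_real (of_bool (N \<omega> = n)))"
      by (intro Bochner_Integration.integral_cong) auto
    then show ?thesis
      using ev[of n] by (simp only: integral_of_real[OF intr])
  qed
  have nb: "norm (of_bool b :: 'b) = of_bool b" for b by (cases b) auto
  have i1: "integrable M (?f n)" for n
    using indep_pair_integrable_mult[OF ind[of n], of "\<lambda>k. of_bool (k = n)" "\<lambda>x. x"] intb int by simp
  have i2: "(\<integral>\<omega>. ?f n \<omega> \<partial>M) = of_real (prob {\<omega> \<in> space M. N \<omega> = n}) * integral\<^sup>L M (F n)" for n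
    using indep_pair_integral_mult[OF ind[of n], of "\<lambda>k. of_bool (k = n)" "\<lambda>x. x"] intb int by (simp add: ev')
  have i3: "(\<integral>\<omega>. norm (?f n \<omega>) \<partial>M) = prob {\<omega> \<in> space M. N \<omega> = n} * expectation (\<lambda>\<omega>. norm (F n \<omega>))" for n
    using indep_pair_integral_mult[OF ind[of n], of "\<lambda>k. of_bool (k = n) :: real" norm] intr int
    by (simp add: ev norm_mult nb)
  have s: "(\<lambda>n. ?f n \<omega>) sums F (N \<omega>) \<omega>" for \<omega>
    using sums_single[of "N \<omega>" "\<lambda>n. F n \<omega>"] by (simp add: of_bool_def if_distrib if_distribR eq_commute cong: if_cong)
  have s': "summable (\<lambda>n. norm (?f n \<omega>))" for \<omega>
    by (rule summable_finite[of "{N \<omega>}"]) auto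
  have eq: "(\<Sum>n. ?f n \<omega>) = F (N \<omega>) \<omega>" for \<omega>
    using s[of \<omega>] by (simp add: sums_iff)
  have sm': "summable (\<lambda>n. \<integral>\<omega>. norm (?f n \<omega>) \<partial>M)"
    using sm unfolding i3 .
  show "integrable M (\<lambda>\<omega>. F (N \<omega>) \<omega>)"
    using integrable_suminf[OF i1 _ sm'] s' unfolding eq by simp
  show "(\<lambda>n. of_real (prob {\<omega> \<in> space M. N \<omega> = n}) * integral\<^sup>L M (F n)) sums (\<integral>\<omega>. F (N \<omega>) \<omega> \<partial>M)"
    using sums_integral[OF i1 _ sm'] s' unfolding eq i2 by simp
qed

text \<open>The triple has the product law of its three components, so the law of U splits off.
  Thinning will supply the independence inside one row and disjoint claims data that between rows;
  this joins the two.\<close>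

lemma (in prob_space) indep_pair_assoc:
  assumes UV: "indep_pair S U P V" and UVO: "indep_pair (S \<Otimes>\<^sub>M P) (\<lambda>\<omega>. (U \<omega>, V \<omega>)) Q W"
  shows "indep_pair S U (P \<Otimes>\<^sub>M Q) (\<lambda>\<omega>. (V \<omega>, W \<omega>))"
  unfolding indep_pair_iff_prob
proof (intro conjI ballI)
  have rv[measurable]: "random_variable S U" "random_variable P V" "random_variable Q W"
    using UV UVO by (auto dest: indep_pair_rv)
  show "random_variable S U" "random_variable (P \<Otimes>\<^sub>M Q) (\<lambda>\<omega>. (V \<omega>, W \<omega>))" by measurable
  have VW: "indep_pair P V Q W"
    using indep_pair_compose[OF UVO, of snd P "\<lambda>x. x" Q] by simp
  fix A K assume A[measurable]: "A \<in> sets S" and K[measurable]: "K \<in> sets (P \<Otimes>\<^sub>M Q)"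
  let ?dU = "distr M S U" and ?dV = "distr M P V" and ?dW = "distr M Q W"
  interpret dU: prob_space ?dU by (rule prob_space_distr) measurable
  interpret dV: prob_space ?dV by (rule prob_space_distr) measurable
  interpret dW: prob_space ?dW by (rule prob_space_distr) measurable
  interpret UVp: pair_prob_space ?dU ?dV ..
  interpret VWp: pair_prob_space ?dV ?dW ..
  interpret UVW: pair_prob_space "?dU \<Otimes>\<^sub>M ?dV" ?dW ..
  \<comment> \<open>The event is placed on the left-nested product, where the hypotheses give the
    product law, while the goal pairs the components to the right.\<close>
  let ?B = "{p \<in> space ((S \<Otimes>\<^sub>M P) \<Otimes>\<^sub>M Q). fst (fst p) \<in> A \<and> (snd (fst p), snd p) \<in> K}"
  have B[measurable]: "?B \<in> sets ((S \<Otimes>\<^sub>M P) \<Otimes>\<^sub>M Q)" by measurable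
  have dUV: "?dU \<Otimes>\<^sub>M ?dV = distr M (S \<Otimes>\<^sub>M P) (\<lambda>\<omega>. (U \<omega>, V \<omega>))"
    using UV by (simp add: indep_pair_def)
  have dUVW: "(?dU \<Otimes>\<^sub>M ?dV) \<Otimes>\<^sub>M ?dW = distr M ((S \<Otimes>\<^sub>M P) \<Otimes>\<^sub>M Q) (\<lambda>\<omega>. ((U \<omega>, V \<omega>), W \<omega>))"
    unfolding dUV using UVO by (simp add: indep_pair_def)
  have dVW: "?dV \<Otimes>\<^sub>M ?dW = distr M (P \<Otimes>\<^sub>M Q) (\<lambda>\<omega>. (V \<omega>, W \<omega>))"
    using VW by (simp add: indep_pair_def)
  have sp: "U \<omega> \<in> space S" "V \<omega> \<in> space P" "W \<omega> \<in> space Q" if "\<omega> \<in> space M" for \<omega>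
    using that measurable_space[OF rv(1)] measurable_space[OF rv(2)] measurable_space[OF rv(3)] by auto
  have "ennreal (prob {\<omega> \<in> space M. U \<omega> \<in> A \<and> (V \<omega>, W \<omega>) \<in> K}) = emeasure ((?dU \<Otimes>\<^sub>M ?dV) \<Otimes>\<^sub>M ?dW) ?B"
    unfolding dUVW emeasure_eq_measure[symmetric]
    by (subst emeasure_distr) (auto simp: space_pair_measure sp intro!: arg_cong[where f="emeasure M"])
  also have "\<dots> = (\<integral>\<^sup>+w. emeasure (?dU \<Otimes>\<^sub>M ?dV) ((\<lambda>x. (x, w)) -` ?B) \<partial>?dW)"
    by (rule UVW.emeasure_pair_measure_alt2) (use B in \<open>simp cong: sets_pair_measure_cong\<close>)
  also have "\<dots> = (\<integral>\<^sup>+w. emeasure ?dU A * emeasure ?dV ((\<lambda>v. (v, w)) -` K) \<partial>?dW)"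
  proof (rule nn_integral_cong)
    fix w assume "w \<in> space ?dW"
    then have w: "w \<in> space Q" by simp
    \<comment> \<open>Freezing w turns the event into a rectangle, so the probability of A leaves
      the integral as a constant factor.\<close>
    have "(\<lambda>x. (x, w)) -` ?B = A \<times> ((\<lambda>v. (v, w)) -` K)"
      using sets.sets_into_space[OF A] sets.sets_into_space[OF K] w
      by (auto simp: space_pair_measure)
    moreover have "(\<lambda>v. (v, w)) -` K \<in> sets ?dV"
      using sets_Pair2[OF K] by simp
    ultimately show "emeasure (?dU \<Otimes>\<^sub>M ?dV) ((\<lambda>x. (x, w)) -` ?B) = emeasure ?dU A * emeasure ?dV ((\<lambda>v. (v, w)) -` K)"
      using dV.emeasure_pair_measure_Times[of A ?dU "(\<lambda>v. (v, w)) -` K"] A by (simp only: sets_distr)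
  qed
  also have "\<dots> = emeasure ?dU A * (\<integral>\<^sup>+w. emeasure ?dV ((\<lambda>v. (v, w)) -` K) \<partial>?dW)"
    by (rule nn_integral_cmult) (rule VWp.measurable_emeasure_Pair2, use K in simp)
  also have "(\<integral>\<^sup>+w. emeasure ?dV ((\<lambda>v. (v, w)) -` K) \<partial>?dW) = emeasure (?dV \<Otimes>\<^sub>M ?dW) K"
    by (rule VWp.emeasure_pair_measure_alt2[symmetric]) (use K in simp)
  also have "emeasure ?dU A * emeasure (?dV \<Otimes>\<^sub>M ?dW) K =
      ennreal (prob {\<omega> \<in> space M. U \<omega> \<in> A} * prob {\<omega> \<in> space M. (V \<omega>, W \<omega>) \<in> K})"
    unfolding dVW by (simp add: emeasure_distr emeasure_eq_measure ennreal_mult'[symmetric] vimage_def Int_def conj_commute)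
  finally show "prob {\<omega> \<in> space M. U \<omega> \<in> A \<and> (V \<omega>, W \<omega>) \<in> K} =
      prob {\<omega> \<in> space M. U \<omega> \<in> A} * prob {\<omega> \<in> space M. (V \<omega>, W \<omega>) \<in> K}"
    by simp
qed

section \<open>Conditional expectations\<close>

text \<open>This holds even for a non-integrable product: \<^const>\<open>real_cond_exp\<close> is the difference of two
  nonnegative conditional expectations, and a nonnegative factor leaves the sign of the other one alone.\<close>

lemma (in sigma_finite_subalgebra) real_cond_exp_mult_nonneg:
  fixes f g :: "'a \<Rightarrow> real"
  assumes f[measurable]: "f \<in> borel_measurable F" and g[measurable]: "g \<in> borel_measurable M"
    and nonneg: "\<And>x. 0 \<le> g x"
  shows "AE x in M. real_cond_exp M F (\<lambda>x. f x * g x) x = f x * real_cond_exp M F g x"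
proof -
  have [measurable]: "f \<in> borel_measurable M" by (rule measurable_from_subalg[OF subalg f])
  have eq: "ennreal (f x * g x) = ennreal (f x) * ennreal (g x)" "ennreal (- (f x * g x)) = ennreal (- f x) * ennreal (g x)"
    "ennreal (- g x) = 0" for x
    using nonneg[of x] ennreal_mult''[of "g x" "- f x"] by (auto simp: ennreal_mult'' ennreal_neg)
  have "AE x in M. ennreal (f x) * nn_cond_exp M F (\<lambda>x. ennreal (g x)) x = nn_cond_exp M F (\<lambda>x. ennreal (f x) * ennreal (g x)) x"
    by (rule nn_cond_exp_prod) auto
  moreover have "AE x in M. ennreal (- f x) * nn_cond_exp M F (\<lambda>x. ennreal (g x)) x = nn_cond_exp M F (\<lambda>x. ennreal (- f x) * ennreal (g x)) x"
    by (rule nn_cond_exp_prod) auto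
  \<comment> \<open>The negative part of g is the zero function; its conditional expectation is 0
    only almost everywhere, hence a third exceptional set.\<close>
  moreover have "AE x in M. 0 = nn_cond_exp M F (\<lambda>x. 0) x"
    by (rule nn_cond_exp_F_meas) auto
  ultimately show ?thesis
  proof eventually_elim
    case (elim x)
    have "enn2real (ennreal (f x)) - enn2real (ennreal (- f x)) = f x"
      by (cases "0 \<le> f x") (auto simp: ennreal_neg)
    then show ?case
      unfolding real_cond_exp_def eq elim(1,2)[symmetric] elim(3)[symmetric]
      by (simp add: enn2real_mult left_diff_distrib[symmetric])
  qed
qed

text \<open>By \<open>gen\<close> each set of the subalgebra is a preimage under W, so its indicator
  is a function of W and integrates against X as a product of expectations. This is the
  characterization of a constant conditional expectation.\<close>

lemma (in prob_space) real_cond_exp_indep: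
  fixes X :: "'a \<Rightarrow> real"
  assumes F: "subalgebra M F" and ind: "indep_pair borel X T W"
    and gen: "\<And>A. A \<in> sets F \<Longrightarrow> \<exists>K\<in>sets T. A = W -` K \<inter> space M"
    and int: "integrable M X"
  shows "AE \<omega> in M. real_cond_exp M F X \<omega> = expectation X"
proof -
  interpret finite_measure_subalgebra M F
    by standard (rule F)
  show ?thesis
  proof (rule real_cond_exp_charact)
    fix A assume "A \<in> sets F"
    then obtain K where K[measurable]: "K \<in> sets T" and A: "A = W -` K \<inter> space M" using gen by auto
    have [measurable]: "W \<in> measurable M T" using ind by (rule indep_pair_rv2)
    have AM: "A \<in> sets M" unfolding A by measurable
    have "set_lebesgue_integral M A X = expectation (\<lambda>\<omega>. X \<omega> * indicator K (W \<omega>))"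
      unfolding set_lebesgue_integral_def by (intro Bochner_Integration.integral_cong) (auto simp: A indicator_def)
    also have "\<dots> = expectation X * expectation (\<lambda>\<omega>. indicator K (W \<omega>))"
    proof -
      have "integrable M (\<lambda>\<omega>. indicator K (W \<omega>) :: real)"
        by (rule integrable_const_bound[where B=1]) (auto simp: indicator_def)
      then show ?thesis
        using int by (intro indep_pair_integral_mult[OF ind, of "\<lambda>x. x"]) auto
    qed
    also have "expectation (\<lambda>\<omega>. indicator K (W \<omega>)) = prob A"
    proof -
      have "expectation (\<lambda>\<omega>. indicator K (W \<omega>) :: real) = expectation (indicator A)"
        by (intro Bochner_Integration.integral_cong) (auto simp: A indicator_def)
      then show ?thesis using AM by simp
    qed
    finally show "set_lebesgue_integral M A X = set_lebesgue_integral M A (\<lambda>_. expectation X)"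
      using AM by (simp add: set_lebesgue_integral_def)
  qed (use int in auto)
qed

text \<open>After expansion of the square, independence makes the conditional moments of U constant
  while powers of V pass through. Only the integrable numerator is expanded; the factor
  \<open>1 / V\<close> returns at the end.\<close>

lemma (in prob_space) cond_exp_quotient:
  fixes U V :: "'a \<Rightarrow> real"
  assumes F: "subalgebra M F" and ind: "indep_pair borel U T W"
    and gen: "\<And>A. A \<in> sets F \<Longrightarrow> \<exists>K\<in>sets T. A = W -` K \<inter> space M"
    and V[measurable]: "V \<in> borel_measurable F"
    and U2: "integrable M (\<lambda>\<omega>. (U \<omega>)\<^sup>2)" and V2: "integrable M (\<lambda>\<omega>. (V \<omega>)\<^sup>2)"
  shows "AE \<omega> in M. real_cond_exp M F (\<lambda>\<omega>. (U \<omega> - b * V \<omega>)\<^sup>2 / V \<omega>) \<omega> =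
    (expectation (\<lambda>\<omega>. (U \<omega>)\<^sup>2) - 2 * b * V \<omega> * expectation U + (b * V \<omega>)\<^sup>2) / V \<omega>"
proof -
  interpret finite_measure_subalgebra M F
    by standard (rule F)
  have [measurable]: "U \<in> borel_measurable M" using ind by (rule indep_pair_rv1)
  have VM[measurable]: "V \<in> borel_measurable M" by (rule measurable_from_subalg[OF F V])
  have U1: "integrable M U" by (rule square_integrable_imp_integrable[OF _ U2]) measurable
  have UV: "integrable M (\<lambda>\<omega>. V \<omega> * U \<omega>)"
  proof (rule Bochner_Integration.integrable_bound)
    show "integrable M (\<lambda>\<omega>. (U \<omega>)\<^sup>2 + (V \<omega>)\<^sup>2)" using U2 V2 by simp
    show "AE \<omega> in M. norm (V \<omega> * U \<omega>) \<le> norm ((U \<omega>)\<^sup>2 + (V \<omega>)\<^sup>2)"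
    proof (rule AE_I2)
      fix \<omega>
      have "2 * (\<bar>V \<omega>\<bar> * \<bar>U \<omega>\<bar>) \<le> (U \<omega>)\<^sup>2 + (V \<omega>)\<^sup>2"
        using sum_squares_bound[of "\<bar>U \<omega>\<bar>" "\<bar>V \<omega>\<bar>"] by (simp add: mult.commute mult.left_commute)
      moreover have "0 \<le> \<bar>V \<omega>\<bar> * \<bar>U \<omega>\<bar>" by simp
      ultimately show "norm (V \<omega> * U \<omega>) \<le> norm ((U \<omega>)\<^sup>2 + (V \<omega>)\<^sup>2)"
        unfolding real_norm_def abs_mult by linarith
    qed
  qed measurable
  have ind2: "indep_pair borel (\<lambda>\<omega>. (U \<omega>)\<^sup>2) T W"
    using indep_pair_compose[OF ind, of "\<lambda>x. x\<^sup>2" borel "\<lambda>x. x" T] by simp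
  have expand: "(U \<omega> - b * V \<omega>)\<^sup>2 = (U \<omega>)\<^sup>2 - (2 * b) * (V \<omega> * U \<omega>) + b\<^sup>2 * (V \<omega>)\<^sup>2" for \<omega>
    by (simp add: power2_diff power_mult_distrib algebra_simps)
  have "AE \<omega> in M. real_cond_exp M F (\<lambda>\<omega>. ((U \<omega>)\<^sup>2 - (2 * b) * (V \<omega> * U \<omega>)) + b\<^sup>2 * (V \<omega>)\<^sup>2) \<omega> =
      real_cond_exp M F (\<lambda>\<omega>. (U \<omega>)\<^sup>2 - (2 * b) * (V \<omega> * U \<omega>)) \<omega> + real_cond_exp M F (\<lambda>\<omega>. b\<^sup>2 * (V \<omega>)\<^sup>2) \<omega>"
    by (rule real_cond_exp_add) (use U2 V2 UV in auto)
  moreover have "AE \<omega> in M. real_cond_exp M F (\<lambda>\<omega>. (U \<omega>)\<^sup>2 - (2 * b) * (V \<omega> * U \<omega>)) \<omega> =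
      real_cond_exp M F (\<lambda>\<omega>. (U \<omega>)\<^sup>2) \<omega> - real_cond_exp M F (\<lambda>\<omega>. (2 * b) * (V \<omega> * U \<omega>)) \<omega>"
    by (rule real_cond_exp_diff) (use U2 UV in auto)
  moreover have "AE \<omega> in M. real_cond_exp M F (\<lambda>\<omega>. (2 * b) * (V \<omega> * U \<omega>)) \<omega> = (2 * b) * real_cond_exp M F (\<lambda>\<omega>. V \<omega> * U \<omega>) \<omega>"
    by (rule real_cond_exp_cmult) (rule UV)
  moreover have "AE \<omega> in M. real_cond_exp M F (\<lambda>\<omega>. V \<omega> * U \<omega>) \<omega> = V \<omega> * real_cond_exp M F U \<omega>"
    by (rule real_cond_exp_mult) (use UV in auto)
  moreover have "AE \<omega> in M. real_cond_exp M F U \<omega> = expectation U"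
    by (rule real_cond_exp_indep[OF F ind gen U1])
  moreover have "AE \<omega> in M. real_cond_exp M F (\<lambda>\<omega>. (U \<omega>)\<^sup>2) \<omega> = expectation (\<lambda>\<omega>. (U \<omega>)\<^sup>2)"
    by (rule real_cond_exp_indep[OF F ind2 gen U2])
  moreover have "AE \<omega> in M. real_cond_exp M F (\<lambda>\<omega>. b\<^sup>2 * (V \<omega>)\<^sup>2) \<omega> = b\<^sup>2 * (V \<omega>)\<^sup>2"
    by (rule real_cond_exp_F_meas) (use V2 in auto)
  \<comment> \<open>The possibly non-integrable quotient enters here, with the square as the
    nonnegative factor.\<close>
  moreover have "AE \<omega> in M. real_cond_exp M F (\<lambda>\<omega>. (1 / V \<omega>) * (U \<omega> - b * V \<omega>)\<^sup>2) \<omega> =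
      (1 / V \<omega>) * real_cond_exp M F (\<lambda>\<omega>. (U \<omega> - b * V \<omega>)\<^sup>2) \<omega>"
    by (rule real_cond_exp_mult_nonneg) auto
  ultimately show ?thesis
    unfolding expand
  proof eventually_elim
    case (elim \<omega>)
    have "real_cond_exp M F (\<lambda>\<omega>. ((U \<omega>)\<^sup>2 - (2 * b) * (V \<omega> * U \<omega>) + b\<^sup>2 * (V \<omega>)\<^sup>2) / V \<omega>) \<omega> =
        real_cond_exp M F (\<lambda>\<omega>. (1 / V \<omega>) * ((U \<omega>)\<^sup>2 - (2 * b) * (V \<omega> * U \<omega>) + b\<^sup>2 * (V \<omega>)\<^sup>2)) \<omega>"
      by simp
    then show ?case
      unfolding elim by (simp add: power_mult_distrib)
  qed
qed

section \<open>Compound Poisson sums\<close>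

text \<open>Pascal's rule for a binomial convolution: raising n by one advances either the first
  sequence or the second, just as a new claim falls into one of two classes.\<close>

lemma sum_choose_pascal:
  fixes a b :: "nat \<Rightarrow> 'a :: comm_semiring_1"
  shows "(\<Sum>m\<le>Suc n. of_nat (Suc n choose m) * a m * b (Suc n - m)) =
    (\<Sum>m\<le>n. of_nat (n choose m) * a (Suc m) * b (n - m)) + (\<Sum>m\<le>n. of_nat (n choose m) * a m * b (Suc (n - m)))"
proof -
  \<comment> \<open>The added term m = Suc n is harmless because \<open>n choose Suc n\<close> is
    0.\<close>
  have "(\<Sum>m\<le>n. of_nat (n choose m) * a m * b (Suc (n - m))) = (\<Sum>m\<le>Suc n. of_nat (n choose m) * a m * b (Suc n - m))"
    by (simp add: Suc_diff_le binomial_eq_0)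
  also have "\<dots> = a 0 * b (Suc n) + (\<Sum>m\<le>n. of_nat (n choose Suc m) * a (Suc m) * b (n - m))"
    by (subst sum.atMost_Suc_shift) simp
  finally show ?thesis
    by (subst sum.atMost_Suc_shift) (simp add: algebra_simps sum.distrib)
qed

text \<open>Marks live in an arbitrary space and sums are formed from functionals of them, so one
  process carries the amounts for all delays at once. Independence is required stepwise, each mark
  from the tuple of its predecessors and the count from each finite tuple, which is what inductions
  over the number of points consume.\<close>

locale compound_poisson = prob_space M for M :: "'a measure" +
  fixes \<mu> :: real and N :: "'a \<Rightarrow> nat" and E :: "'e measure" and X :: "nat \<Rightarrow> 'a \<Rightarrow> 'e" and \<nu> :: "'e measure"
  assumes mu_nonneg: "0 \<le> \<mu>"
    and N_poisson: "\<And>n. prob {\<omega> \<in> space M. N \<omega> = n} = \<mu> ^ n / fact n * exp (- \<mu>)"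
    and X_distr: "\<And>k. 1 \<le> k \<Longrightarrow> distr M E (X k) = \<nu>"
    and step_indep: "\<And>n. indep_pair (PiM {1..n} (\<lambda>_. E)) (\<lambda>\<omega>. \<lambda>k\<in>{1..n}. X k \<omega>) E (X (Suc n))"
    and N_indep: "\<And>n. indep_pair (count_space UNIV) N (PiM {1..n} (\<lambda>_. E)) (\<lambda>\<omega>. \<lambda>k\<in>{1..n}. X k \<omega>)"
begin

definition S :: "('e \<Rightarrow> real) \<Rightarrow> nat \<Rightarrow> 'a \<Rightarrow> real" where
  "S u n \<omega> = (\<Sum>k = 1..n. u (X k \<omega>))"

lemma N_meas[measurable]: "N \<in> measurable M (count_space UNIV)"
  using N_indep[of 0] by (rule indep_pair_rv1)

lemma X_meas: "1 \<le> k \<Longrightarrow> X k \<in> measurable M E"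
  using step_indep[of "k - 1"] by (auto dest!: indep_pair_rv2)

lemma sets_nu[measurable_cong]: "sets \<nu> = sets E"
  using X_distr[of 1] by auto

lemma space_nu: "space \<nu> = space E"
  using X_distr[of 1] by auto

lemma prob_space_nu: "prob_space \<nu>"
  using X_distr[of 1] prob_space_distr[OF X_meas[of 1]] by simp

lemma S_0[simp]: "S u 0 \<omega> = 0"
  by (simp add: S_def)

lemma S_Suc: "S u (Suc n) \<omega> = S u n \<omega> + u (X (Suc n) \<omega>)"
  by (simp add: S_def)

lemma S_meas[measurable]:
  assumes [measurable]: "u \<in> borel_measurable E"
  shows "S u n \<in> borel_measurable M"
  unfolding S_def
proof (intro borel_measurable_sum)
  fix k assume "k \<in> {1..n}"
  then have [measurable]: "X k \<in> measurable M E" by (auto intro: X_meas)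
  show "(\<lambda>\<omega>. u (X k \<omega>)) \<in> borel_measurable M" by measurable
qed

lemma S_random_meas[measurable]:
  assumes [measurable]: "u \<in> borel_measurable E"
  shows "(\<lambda>\<omega>. S u (N \<omega>) \<omega>) \<in> borel_measurable M"
  by (rule measurable_compose_countable) auto

lemma partial_sum_meas:
  fixes u :: "'e \<Rightarrow> real"
  assumes [measurable]: "u \<in> borel_measurable E"
  shows "(\<lambda>x. \<Sum>k = 1..n. u (x k)) \<in> borel_measurable (PiM {1..n} (\<lambda>_. E))"
proof (rule borel_measurable_sum[where f = "\<lambda>k x. u (x k)"])
  fix k assume "k \<in> {1..n}"
  then have [measurable]: "(\<lambda>x. x k) \<in> measurable (PiM {1..n} (\<lambda>_. E)) E" by simp
  show "(\<lambda>x. u (x k)) \<in> borel_measurable (PiM {1..n} (\<lambda>_. E))" by measurable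
qed

lemma N_indep_of_points:
  assumes g: "g \<in> measurable (PiM {1..n} (\<lambda>_. E)) T"
    and eq: "\<And>\<omega>. G \<omega> = g (\<lambda>k\<in>{1..n}. X k \<omega>)"
  shows "indep_pair (count_space UNIV) N T G"
  using indep_pair_compose[OF N_indep[of n] measurable_ident g] by (simp add: eq[abs_def])

lemma step_indep_of_points:
  assumes g: "g \<in> measurable (PiM {1..n} (\<lambda>_. E)) T"
    and eq: "\<And>\<omega>. G \<omega> = g (\<lambda>k\<in>{1..n}. X k \<omega>)"
  shows "indep_pair T G E (X (Suc n))"
  using indep_pair_compose[OF step_indep[of n] g measurable_ident] by (simp add: eq[abs_def])

lemma S_eq_points: "S u n \<omega> = (\<lambda>x. \<Sum>k = 1..n. u (x k)) (\<lambda>k\<in>{1..n}. X k \<omega>)"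
  by (simp add: S_def)

text \<open>The probability generating function of the count. At c = 1 it is the total mass, which
  also majorizes series with bounded coefficients.\<close>

lemma poisson_weights_sums: "(\<lambda>n. prob {\<omega> \<in> space M. N \<omega> = n} * c ^ n) sums exp (\<mu> * (c - 1))" for c
proof -
  have "(\<lambda>n. exp (-\<mu>) * ((\<mu> * c) ^ n /\<^sub>R fact n)) sums (exp (-\<mu>) * exp (\<mu> * c))"
    by (intro sums_mult exp_converges)
  then show ?thesis
    unfolding N_poisson by (simp add: exp_add[symmetric] algebra_simps power_mult_distrib divide_inverse)
qed

lemma N_summable_bounded:
  assumes "\<And>n. norm (c n) \<le> (B::real)"
  shows "summable (\<lambda>n. prob {\<omega> \<in> space M. N \<omega> = n} * c n)"
proof (rule summable_comparison_test')
  show "summable (\<lambda>n. prob {\<omega> \<in> space M. N \<omega> = n} * 1 ^ n * B)"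
    by (intro summable_mult2 sums_summable[OF poisson_weights_sums])
  show "norm (prob {\<omega> \<in> space M. N \<omega> = n} * c n) \<le> prob {\<omega> \<in> space M. N \<omega> = n} * 1 ^ n * B" for n
    using assms[of n] by (auto simp: abs_mult intro!: mult_left_mono)
qed

text \<open>Given n points the characteristic function is the n-th power of that of one mark;
  averaging over the count evaluates the Poisson generating function at this number.\<close>

lemma char_S:
  assumes [measurable]: "u \<in> borel_measurable E"
  shows "char (distr M borel (\<lambda>\<omega>. S u (N \<omega>) \<omega>)) t = exp (of_real \<mu> * (char (distr \<nu> borel u) t - 1))"
proof -
  interpret nu: prob_space \<nu> by (rule prob_space_nu)
  let ?\<phi> = "char (distr \<nu> borel u) t"
  have [measurable]: "X (Suc n) \<in> measurable M E" for n by (rule X_meas) simp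
  have ph: "(CLINT \<omega>|M. iexp (t * u (X (Suc n) \<omega>))) = ?\<phi>" for n
  proof -
    have "(CLINT e|\<nu>. iexp (t * u e)) = (CLINT \<omega>|M. iexp (t * u (X (Suc n) \<omega>)))"
      unfolding X_distr[of "Suc n", simplified, symmetric]
      by (intro integral_distr) auto
    moreover have "?\<phi> = (CLINT e|\<nu>. iexp (t * u e))"
      unfolding char_def by (subst integral_distr) auto
    ultimately show ?thesis by simp
  qed
  have F: "(CLINT \<omega>|M. iexp (t * S u n \<omega>)) = ?\<phi> ^ n" for n
  proof (induction n)
    case 0
    show ?case by (simp add: prob_space)
  next
    case (Suc n)
    have i: "indep_pair borel (S u n) E (X (Suc n))"
      by (rule step_indep_of_points[OF partial_sum_meas S_eq_points]) measurable
    have "(CLINT \<omega>|M. iexp (t * S u (Suc n) \<omega>)) = (CLINT \<omega>|M. iexp (t * S u n \<omega>) * iexp (t * u (X (Suc n) \<omega>)))"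
      by (simp add: S_Suc algebra_simps exp_add)
    also have "\<dots> = (CLINT \<omega>|M. iexp (t * S u n \<omega>)) * (CLINT \<omega>|M. iexp (t * u (X (Suc n) \<omega>)))"
      by (intro indep_pair_integral_mult[OF i] integrable_iexp) auto
    finally show ?case using Suc ph by simp
  qed
  have "(\<lambda>n. of_real (prob {\<omega> \<in> space M. N \<omega> = n}) * (CLINT \<omega>|M. iexp (t * S u n \<omega>))) sums (CLINT \<omega>|M. iexp (t * S u (N \<omega>) \<omega>))"
  proof (rule random_index_sums)
    have i: "indep_pair (count_space UNIV) N borel (S u n)" for n
      by (rule N_indep_of_points[OF partial_sum_meas S_eq_points]) measurable
    show "indep_pair (count_space UNIV) N borel (\<lambda>\<omega>. iexp (t * S u n \<omega>))" for n
      using indep_pair_compose[OF i[of n], of "\<lambda>x. x" "count_space UNIV" "\<lambda>e. iexp (t * e)" borel] by simp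
    show "integrable M (\<lambda>\<omega>. iexp (t * S u n \<omega>))" for n by (rule integrable_iexp) auto
    show "summable (\<lambda>n. prob {\<omega> \<in> space M. N \<omega> = n} * expectation (\<lambda>\<omega>. norm (iexp (t * S u n \<omega>))))"
      by (rule N_summable_bounded[where B=1]) (simp add: prob_space)
  qed
  moreover have "(\<lambda>n. of_real (prob {\<omega> \<in> space M. N \<omega> = n}) * ?\<phi> ^ n) sums exp (of_real \<mu> * (?\<phi> - 1))"
  proof -
    \<comment> \<open>The exponential series is summed anew because the argument of the generating
      function is now complex.\<close>
    have "(\<lambda>n. of_real (exp (-\<mu>)) * ((of_real \<mu> * ?\<phi>) ^ n /\<^sub>R fact n)) sums (of_real (exp (-\<mu>)) * exp (of_real \<mu> * ?\<phi>))"
      by (intro sums_mult exp_converges)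
    moreover have "of_real (exp (-\<mu>)) * exp (of_real \<mu> * ?\<phi>) = exp (of_real \<mu> * (?\<phi> - 1))"
      by (simp add: exp_of_real[symmetric] exp_add[symmetric] algebra_simps)
    moreover have "of_real (exp (-\<mu>)) * ((of_real \<mu> * ?\<phi>) ^ n /\<^sub>R fact n) = of_real (prob {\<omega> \<in> space M. N \<omega> = n}) * ?\<phi> ^ n" for n
      unfolding N_poisson by (simp add: power_mult_distrib scaleR_conv_of_real field_simps)
    ultimately show ?thesis by simp
  qed
  ultimately have "(CLINT \<omega>|M. iexp (t * S u (N \<omega>) \<omega>)) = exp (of_real \<mu> * (?\<phi> - 1))"
    unfolding F by (rule sums_unique2)
  then show ?thesis
    by (simp add: char_def integral_distr)
qed

section \<open>Moments of the count and of the compound sum\<close>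

lemma poisson_sums_shift:
  assumes "(\<lambda>n. prob {\<omega> \<in> space M. N \<omega> = n} * c (Suc n)) sums s"
  shows "(\<lambda>n. prob {\<omega> \<in> space M. N \<omega> = n} * (real n * c n)) sums (\<mu> * s)"
proof -
  \<comment> \<open>This is the Chen-Stein identity E[N c(N)] = \<mu> E[c(N + 1)]: the factor n
    cancels against n!, and the term for n = 0 vanishes.\<close>
  have "prob {\<omega> \<in> space M. N \<omega> = Suc n} * (real (Suc n) * c (Suc n)) = \<mu> * (prob {\<omega> \<in> space M. N \<omega> = n} * c (Suc n))" for n
    unfolding N_poisson by (simp add: field_simps flip: of_nat_Suc)
  then have "(\<lambda>n. prob {\<omega> \<in> space M. N \<omega> = Suc n} * (real (Suc n) * c (Suc n))) sums (\<mu> * s)"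
    using sums_mult[OF assms, of \<mu>] by (simp only:)
  then show ?thesis
    by (subst (asm) sums_Suc_iff) simp
qed

lemma poisson_weight_sums: "(\<lambda>n. prob {\<omega> \<in> space M. N \<omega> = n}) sums 1"
  using poisson_weights_sums[of 1] by simp

lemma poisson_moment1_sums: "(\<lambda>n. prob {\<omega> \<in> space M. N \<omega> = n} * real n) sums \<mu>"
  using poisson_sums_shift[of "\<lambda>_. 1" 1] poisson_weight_sums by simp

text \<open>The shift identity with c the identity gives E[N^2] = \<mu> E[N + 1].\<close>

lemma poisson_moment2_sums: "(\<lambda>n. prob {\<omega> \<in> space M. N \<omega> = n} * (real n)\<^sup>2) sums (\<mu> * (\<mu> + 1))"
proof -
  have "(\<lambda>n. prob {\<omega> \<in> space M. N \<omega> = n} * real n + prob {\<omega> \<in> space M. N \<omega> = n}) sums (\<mu> + 1)"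
    by (intro sums_add poisson_moment1_sums poisson_weight_sums)
  then show ?thesis
    using poisson_sums_shift[of real "\<mu> + 1"] by (simp add: algebra_simps power2_eq_square)
qed

lemma N_expectation: "expectation (\<lambda>\<omega>. real (N \<omega>)) = \<mu>"
proof -
  have "(\<lambda>n. of_real (prob {\<omega> \<in> space M. N \<omega> = n}) * expectation (\<lambda>\<omega>. real n)) sums expectation (\<lambda>\<omega>. real (N \<omega>))"
  proof (rule random_index_sums[where F="\<lambda>n \<omega>. real n"])
    \<comment> \<open>With n = 0 the tuple of marks is empty, and a constant is a function of
      it.\<close>
    show "indep_pair (count_space UNIV) N borel (\<lambda>\<omega>. real n)" for n
      by (rule N_indep_of_points[where n=0]) auto
    show "summable (\<lambda>n. prob {\<omega> \<in> space M. N \<omega> = n} * expectation (\<lambda>\<omega>. norm (real n)))"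
      using sums_summable[OF poisson_moment1_sums] by (simp add: prob_space)
  qed simp
  then show ?thesis
    using poisson_moment1_sums by (simp add: prob_space sums_iff)
qed

text \<open>With n points the second moment is n (s - m^2) + n^2 m^2. Averaging with E[N] = \<mu>
  and E[N^2] = \<mu> (\<mu> + 1) cancels the terms in \<mu> m^2, so the variance of the random sum
  is \<mu> times the raw second moment of a mark.\<close>

lemma
  assumes [measurable]: "u \<in> borel_measurable E" and sq: "integrable \<nu> (\<lambda>e. (u e)\<^sup>2)"
  shows S_sq_integrable: "integrable M (\<lambda>\<omega>. (S u (N \<omega>) \<omega>)\<^sup>2)"
    and S_expectation: "expectation (\<lambda>\<omega>. S u (N \<omega>) \<omega>) = \<mu> * (\<integral>e. u e \<partial>\<nu>)"
    and S_sq_expectation: "expectation (\<lambda>\<omega>. (S u (N \<omega>) \<omega>)\<^sup>2) = \<mu> * (\<integral>e. (u e)\<^sup>2 \<partial>\<nu>) + (\<mu> * (\<integral>e. u e \<partial>\<nu>))\<^sup>2"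
proof -
  interpret nu: prob_space \<nu> by (rule prob_space_nu)
  define m where "m = (\<integral>e. u e \<partial>\<nu>)"
  define s where "s = (\<integral>e. (u e)\<^sup>2 \<partial>\<nu>)"
  have [measurable]: "X (Suc n) \<in> measurable M E" for n by (rule X_meas) simp
  have u1: "integrable \<nu> u"
    by (rule nu.square_integrable_imp_integrable[OF _ sq]) measurable
  have X2: "integrable M (\<lambda>\<omega>. (u (X (Suc n) \<omega>))\<^sup>2)" for n
    using sq unfolding X_distr[of "Suc n", simplified, symmetric] by (subst (asm) integrable_distr_eq) auto
  have X1: "integrable M (\<lambda>\<omega>. u (X (Suc n) \<omega>))" for n
    using u1 unfolding X_distr[of "Suc n", simplified, symmetric] by (subst (asm) integrable_distr_eq) auto
  have EX1: "expectation (\<lambda>\<omega>. u (X (Suc n) \<omega>)) = m" for n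
    unfolding m_def X_distr[of "Suc n", simplified, symmetric] by (subst integral_distr) auto
  have EX2: "expectation (\<lambda>\<omega>. (u (X (Suc n) \<omega>))\<^sup>2) = s" for n
    unfolding s_def X_distr[of "Suc n", simplified, symmetric] by (subst integral_distr) auto
  have i: "indep_pair borel (S u n) E (X (Suc n))" for n
    by (rule step_indep_of_points[OF partial_sum_meas S_eq_points]) measurable
  have iN: "indep_pair (count_space UNIV) N borel (S u n)" for n
    by (rule N_indep_of_points[OF partial_sum_meas S_eq_points]) measurable
  have "integrable M (S u n) \<and> expectation (S u n) = real n * m" for n
  proof (induction n)
    case 0
    have "S u 0 = (\<lambda>_. 0)" by auto
    then show ?case by simp
  next
    case (Suc n)
    have "S u (Suc n) = (\<lambda>\<omega>. S u n \<omega> + u (X (Suc n) \<omega>))" by (auto simp: S_Suc)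
    then show ?case using Suc X1[of n] EX1[of n] by (simp add: algebra_simps)
  qed
  then have S1: "integrable M (S u n)" and ES1: "expectation (S u n) = real n * m" for n by auto
  have S12: "integrable M (\<lambda>\<omega>. S u n \<omega> * u (X (Suc n) \<omega>))"
    "expectation (\<lambda>\<omega>. S u n \<omega> * u (X (Suc n) \<omega>)) = real n * m * m" for n
    using indep_pair_integrable_mult[OF i, of "\<lambda>x. x" u n] indep_pair_integral_mult[OF i, of "\<lambda>x. x" u n] S1 X1 ES1 EX1
    by auto
  have "integrable M (\<lambda>\<omega>. (S u n \<omega>)\<^sup>2) \<and> expectation (\<lambda>\<omega>. (S u n \<omega>)\<^sup>2) = real n * (s - m\<^sup>2) + (real n)\<^sup>2 * m\<^sup>2" for n
  proof (induction n)
    case 0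
    show ?case by simp
  next
    case (Suc n)
    have "(S u (Suc n) \<omega>)\<^sup>2 = (S u n \<omega>)\<^sup>2 + (2 * (S u n \<omega> * u (X (Suc n) \<omega>)) + (u (X (Suc n) \<omega>))\<^sup>2)" for \<omega>
      by (simp add: S_Suc power2_eq_square algebra_simps)
    then show ?case using Suc X2[of n] EX2[of n] S12[of n]
      by (simp add: algebra_simps power2_eq_square)
  qed
  then have S2: "integrable M (\<lambda>\<omega>. (S u n \<omega>)\<^sup>2)"
    and ES2: "expectation (\<lambda>\<omega>. (S u n \<omega>)\<^sup>2) = real n * (s - m\<^sup>2) + (real n)\<^sup>2 * m\<^sup>2" for n by auto
  have sums2: "(\<lambda>n. prob {\<omega> \<in> space M. N \<omega> = n} * expectation (\<lambda>\<omega>. (S u n \<omega>)\<^sup>2)) sums (\<mu> * (s - m\<^sup>2) + \<mu> * (\<mu> + 1) * m\<^sup>2)"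
    using sums_add[OF sums_mult2[OF poisson_moment1_sums] sums_mult2[OF poisson_moment2_sums], of "s - m\<^sup>2" "m\<^sup>2"]
    by (simp add: ES2 algebra_simps)
  have ind2: "indep_pair (count_space UNIV) N borel (\<lambda>\<omega>. (S u n \<omega>)\<^sup>2)" for n
    using indep_pair_compose[OF iN[of n], of "\<lambda>x. x" "count_space UNIV" "\<lambda>e. e\<^sup>2" borel] by simp
  have sm2: "summable (\<lambda>n. prob {\<omega> \<in> space M. N \<omega> = n} * expectation (\<lambda>\<omega>. norm ((S u n \<omega>)\<^sup>2)))"
    using sums_summable[OF sums2] by simp
  show int2: "integrable M (\<lambda>\<omega>. (S u (N \<omega>) \<omega>)\<^sup>2)"
    by (rule random_index_integrable[OF ind2 S2 sm2])
  have "(\<lambda>n. prob {\<omega> \<in> space M. N \<omega> = n} * expectation (\<lambda>\<omega>. (S u n \<omega>)\<^sup>2)) sums expectation (\<lambda>\<omega>. (S u (N \<omega>) \<omega>)\<^sup>2)"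
    using random_index_sums[OF ind2 S2 sm2] by simp
  from sums_unique2[OF this sums2]
  show "expectation (\<lambda>\<omega>. (S u (N \<omega>) \<omega>)\<^sup>2) = \<mu> * (\<integral>e. (u e)\<^sup>2 \<partial>\<nu>) + (\<mu> * (\<integral>e. u e \<partial>\<nu>))\<^sup>2"
    unfolding m_def[symmetric] s_def[symmetric] by (simp add: algebra_simps power2_eq_square)
  \<comment> \<open>The bound |x| \<le> x^2 + 1, a consequence of (|x| - 1/2)^2 \<ge> 0, reduces
    this to the second moments summed above.\<close>
  have sm1: "summable (\<lambda>n. prob {\<omega> \<in> space M. N \<omega> = n} * expectation (\<lambda>\<omega>. norm (S u n \<omega>)))"
  proof (rule summable_comparison_test')
    show "summable (\<lambda>n. prob {\<omega> \<in> space M. N \<omega> = n} * expectation (\<lambda>\<omega>. (S u n \<omega>)\<^sup>2) + prob {\<omega> \<in> space M. N \<omega> = n})"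
      by (intro summable_add sums_summable[OF sums2] sums_summable[OF poisson_weight_sums])
    fix n
    have "expectation (\<lambda>\<omega>. norm (S u n \<omega>)) \<le> expectation (\<lambda>\<omega>. (S u n \<omega>)\<^sup>2 + 1)"
    proof (rule integral_mono)
      fix \<omega>
      have "0 \<le> (\<bar>S u n \<omega>\<bar> - 1 / 2)\<^sup>2" by simp
      then show "norm (S u n \<omega>) \<le> (S u n \<omega>)\<^sup>2 + 1" by (simp add: power2_diff power_divide)
    qed (use S1 S2 in auto)
    also have "\<dots> = expectation (\<lambda>\<omega>. (S u n \<omega>)\<^sup>2) + 1" using S2 by (simp add: prob_space)
    finally have "prob {\<omega> \<in> space M. N \<omega> = n} * expectation (\<lambda>\<omega>. norm (S u n \<omega>)) \<le>
        prob {\<omega> \<in> space M. N \<omega> = n} * (expectation (\<lambda>\<omega>. (S u n \<omega>)\<^sup>2) + 1)"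
      by (intro mult_left_mono) auto
    then show "norm (prob {\<omega> \<in> space M. N \<omega> = n} * expectation (\<lambda>\<omega>. norm (S u n \<omega>)))
        \<le> prob {\<omega> \<in> space M. N \<omega> = n} * expectation (\<lambda>\<omega>. (S u n \<omega>)\<^sup>2) + prob {\<omega> \<in> space M. N \<omega> = n}"
      by (simp add: abs_mult algebra_simps)
  qed
  have "(\<lambda>n. prob {\<omega> \<in> space M. N \<omega> = n} * expectation (S u n)) sums expectation (\<lambda>\<omega>. S u (N \<omega>) \<omega>)"
    using random_index_sums[OF iN S1 sm1] by simp
  moreover have "(\<lambda>n. prob {\<omega> \<in> space M. N \<omega> = n} * expectation (S u n)) sums (\<mu> * m)"
    using sums_mult2[OF poisson_moment1_sums, of m] by (simp add: ES1 algebra_simps)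
  ultimately show "expectation (\<lambda>\<omega>. S u (N \<omega>) \<omega>) = \<mu> * (\<integral>e. u e \<partial>\<nu>)"
    unfolding m_def by (rule sums_unique2)
qed

section \<open>Thinning: independence of two complementary parts of the sum\<close>

definition V :: "('e \<Rightarrow> nat \<Rightarrow> real) \<Rightarrow> nat \<Rightarrow> 'a \<Rightarrow> nat \<Rightarrow> real" where
  "V c n \<omega> = (\<lambda>t. S (\<lambda>e. c e t) n \<omega>)"

lemma V_meas[measurable]:
  assumes c: "c \<in> measurable E (PiM UNIV (\<lambda>_. borel))"
  shows "V c n \<in> measurable M (PiM UNIV (\<lambda>_. borel))"
proof -
  have [measurable]: "(\<lambda>e. c e t) \<in> borel_measurable E" for t
    using measurable_compose[OF c measurable_component_singleton[of t UNIV "\<lambda>_. borel"]] by simp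
  show ?thesis
    by (rule measurable_PiM_single') (auto simp: V_def)
qed

text \<open>Conditioning on whether the last point lies in A or not turns the expectation of a product of
  functions of the two thinned sums into a Pascal recursion, so it obeys a binomial expansion.\<close>

lemma thinned_expectation_binomial:
  fixes u :: "'e \<Rightarrow> real" and c :: "'e \<Rightarrow> nat \<Rightarrow> real"
  assumes u[measurable]: "u \<in> borel_measurable E" and c[measurable]: "c \<in> measurable E (PiM UNIV (\<lambda>_. borel))"
    and A[measurable]: "A \<in> sets E"
    and uA: "\<And>e. e \<in> A \<Longrightarrow> u e = 0" and cA: "\<And>e. e \<in> space E \<Longrightarrow> e \<notin> A \<Longrightarrow> c e = (\<lambda>_. 0)"
    and \<phi>: "\<phi> \<in> borel_measurable borel" "\<And>x. \<bar>\<phi> x\<bar> \<le> 1"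
    and \<psi>: "\<psi> \<in> borel_measurable (PiM UNIV (\<lambda>_. borel))" "\<And>y. \<bar>\<psi> y\<bar> \<le> 1"
  defines "R \<equiv> \<lambda>(\<phi> :: real \<Rightarrow> real) x. \<integral>e. indicator (space E - A) e * \<phi> (x + u e) \<partial>\<nu>"
    and "Q \<equiv> \<lambda>(\<psi> :: (nat \<Rightarrow> real) \<Rightarrow> real) y. \<integral>e. indicator A e * \<psi> (\<lambda>t. y t + c e t) \<partial>\<nu>"
  shows "expectation (\<lambda>\<omega>. \<phi> (S u n \<omega>) * \<psi> (V c n \<omega>)) =
    (\<Sum>m\<le>n. of_nat (n choose m) * (R ^^ m) \<phi> 0 * (Q ^^ (n - m)) \<psi> (\<lambda>_. 0))"
  using \<phi> \<psi>
\<comment> \<open>The test functions must vary: adding a point replaces either \<phi> by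
  \<open>R \<phi>\<close> or \<psi> by \<open>Q \<psi>\<close>.\<close>
proof (induction n arbitrary: \<phi> \<psi>)
  case 0
  then show ?case by (simp add: prob_space V_def)
next
  case (Suc n)
  interpret nu: prob_space \<nu> by (rule prob_space_nu)
  let ?P = "PiM UNIV (\<lambda>_::nat. borel :: real measure)"
  note [measurable] = Suc.prems(1,3)
  have [measurable]: "X (Suc n) \<in> measurable M E" by (rule X_meas) simp
  have ct[measurable]: "(\<lambda>e. c e t) \<in> borel_measurable E" for t
    using measurable_compose[OF c measurable_component_singleton[of t UNIV "\<lambda>_. borel"]] by simp
  have add[measurable]: "(\<lambda>p. (\<lambda>t. fst p t + c (snd p) t)) \<in> measurable (?P \<Otimes>\<^sub>M E) ?P"
  proof (rule measurable_PiM_single')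
    fix t :: nat
    have [measurable]: "(\<lambda>p. fst p t) \<in> borel_measurable (?P \<Otimes>\<^sub>M E)"
      by (rule measurable_compose[OF measurable_fst]) simp
    show "(\<lambda>p. fst p t + c (snd p) t) \<in> borel_measurable (?P \<Otimes>\<^sub>M E)"
      by measurable
  qed auto
  have mR[measurable]: "R \<phi> \<in> borel_measurable borel"
    unfolding R_def by measurable
  have mQ[measurable]: "Q \<psi> \<in> borel_measurable ?P"
  proof -
    have "(\<lambda>(y, e). indicator A e * \<psi> (\<lambda>t. y t + c e t)) \<in> borel_measurable (?P \<Otimes>\<^sub>M \<nu>)"
      using measurable_compose[OF add Suc.prems(3)] by (simp add: case_prod_beta')
    then show ?thesis
      unfolding Q_def by measurable
  qed
  have intR: "integrable \<nu> (\<lambda>e. indicator (space E - A) e * \<phi> (x + u e))" for x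
    using Suc.prems(2) by (intro nu.integrable_const_bound[where B=1]) (auto simp: indicator_def)
  have intQ: "integrable \<nu> (\<lambda>e. indicator A e * \<psi> (\<lambda>t. y t + c e t))" if "y \<in> space ?P" for y
  proof (intro nu.integrable_const_bound[where B=1])
    have "(\<lambda>e. \<psi> (\<lambda>t. y t + c e t)) \<in> borel_measurable E"
      using measurable_compose[OF measurable_Pair1'[OF that] measurable_compose[OF add Suc.prems(3)]] by simp
    then show "(\<lambda>e. indicator A e * \<psi> (\<lambda>t. y t + c e t)) \<in> borel_measurable \<nu>"
      by measurable
  qed (use Suc.prems(4) in \<open>auto simp: indicator_def\<close>)
  \<comment> \<open>R and Q integrate over part of a probability space, so the bound 1 survives and
    the induction hypothesis applies to the new test functions.\<close>
  have bR: "\<bar>R \<phi> x\<bar> \<le> 1" for x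
  proof -
    have "\<bar>R \<phi> x\<bar> \<le> (\<integral>e. 1 \<partial>\<nu>)"
      unfolding R_def using Suc.prems(2)
      by (intro order_trans[OF integral_abs_bound] integral_mono integrable_abs intR) (auto simp: indicator_def)
    then show ?thesis by (simp add: nu.prob_space)
  qed
  have bQ: "\<bar>Q \<psi> y\<bar> \<le> 1" for y
  proof -
    have "y \<in> space ?P" by (simp add: space_PiM)
    then have "\<bar>Q \<psi> y\<bar> \<le> (\<integral>e. 1 \<partial>\<nu>)"
      unfolding Q_def using Suc.prems(4)
      by (intro order_trans[OF integral_abs_bound] integral_mono integrable_abs intQ) (auto simp: indicator_def)
    then show ?thesis by (simp add: nu.prob_space)
  qed
  let ?f = "\<lambda>p. \<phi> (fst (fst p) + u (snd p)) * \<psi> (\<lambda>t. snd (fst p) t + c (snd p) t)"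
  have add'[measurable]: "(\<lambda>p. (\<lambda>t. snd (fst p) t + c (snd p) t)) \<in> measurable ((borel \<Otimes>\<^sub>M ?P) \<Otimes>\<^sub>M E) ?P"
    using measurable_compose[where f = "\<lambda>p. (snd (fst p), snd p)" and M = "(borel \<Otimes>\<^sub>M ?P) \<Otimes>\<^sub>M E", OF _ add] by simp
  have f[measurable]: "?f \<in> borel_measurable ((borel \<Otimes>\<^sub>M ?P) \<Otimes>\<^sub>M E)"
    by measurable
  have ind: "indep_pair (borel \<Otimes>\<^sub>M ?P) (\<lambda>\<omega>. (S u n \<omega>, V c n \<omega>)) E (X (Suc n))"
  proof (rule step_indep_of_points)
    show "(\<lambda>x. (\<Sum>k = 1..n. u (x k), \<lambda>t. \<Sum>k = 1..n. c (x k) t)) \<in> measurable (PiM {1..n} (\<lambda>_. E)) (borel \<Otimes>\<^sub>M ?P)"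
      by (intro measurable_Pair partial_sum_meas u measurable_PiM_single') (auto intro: partial_sum_meas[OF ct])
  qed (simp add: S_def V_def)
  have "expectation (\<lambda>\<omega>. \<phi> (S u (Suc n) \<omega>) * \<psi> (V c (Suc n) \<omega>)) = expectation (\<lambda>\<omega>. ?f ((S u n \<omega>, V c n \<omega>), X (Suc n) \<omega>))"
    by (simp add: S_Suc V_def)
  also have "\<dots> = expectation (\<lambda>\<omega>. (\<integral>e. ?f ((S u n \<omega>, V c n \<omega>), e) \<partial>\<nu>))"
  proof -
    have "integrable M (\<lambda>\<omega>. ?f ((S u n \<omega>, V c n \<omega>), X (Suc n) \<omega>))"
    proof (rule integrable_const_bound[where B=1])
      have "(\<lambda>\<omega>. ((S u n \<omega>, V c n \<omega>), X (Suc n) \<omega>)) \<in> measurable M ((borel \<Otimes>\<^sub>M ?P) \<Otimes>\<^sub>M E)"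
        by measurable
      from measurable_compose[OF this f] show "(\<lambda>\<omega>. ?f ((S u n \<omega>, V c n \<omega>), X (Suc n) \<omega>)) \<in> borel_measurable M" .
    qed (use Suc.prems(2,4) in \<open>auto simp: abs_mult intro!: mult_le_one\<close>)
    from indep_pair_integral_iterated[OF ind f this] show ?thesis
      by (simp add: X_distr)
  qed
  also have "\<dots> = expectation (\<lambda>\<omega>. R \<phi> (S u n \<omega>) * \<psi> (V c n \<omega>) + \<phi> (S u n \<omega>) * Q \<psi> (V c n \<omega>))"
  proof (intro Bochner_Integration.integral_cong refl)
    fix \<omega>
    let ?x = "S u n \<omega>" and ?y = "V c n \<omega>"
    have y: "?y \<in> space ?P" by (simp add: space_PiM)
    \<comment> \<open>On A the increment u vanishes, so \<phi> keeps its argument; off A the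
      increment c vanishes, so \<psi> keeps its own. Each half of the mark space moves only one
      factor.\<close>
    have "(\<integral>e. ?f ((?x, ?y), e) \<partial>\<nu>) =
      (\<integral>e. indicator (space E - A) e * \<phi> (?x + u e) * \<psi> ?y + \<phi> ?x * (indicator A e * \<psi> (\<lambda>t. ?y t + c e t)) \<partial>\<nu>)"
      using uA cA by (intro Bochner_Integration.integral_cong) (auto simp: space_nu indicator_def)
    also have "\<dots> = R \<phi> ?x * \<psi> ?y + \<phi> ?x * Q \<psi> ?y"
      unfolding R_def Q_def
      by (subst Bochner_Integration.integral_add) (use intR[of ?x] intQ[OF y] in auto)
    finally show "(\<integral>e. ?f ((?x, ?y), e) \<partial>\<nu>) = R \<phi> ?x * \<psi> ?y + \<phi> ?x * Q \<psi> ?y" .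
  qed
  also have "\<dots> = expectation (\<lambda>\<omega>. R \<phi> (S u n \<omega>) * \<psi> (V c n \<omega>)) + expectation (\<lambda>\<omega>. \<phi> (S u n \<omega>) * Q \<psi> (V c n \<omega>))"
    using Suc.prems(2,4) bR bQ
    by (intro Bochner_Integration.integral_add integrable_const_bound[where B=1]) (auto simp: abs_mult intro!: mult_le_one)
  \<comment> \<open>The induction hypothesis is used twice, for the pair \<open>R \<phi>\<close>,
    \<psi> and for the pair \<phi>, \<open>Q \<psi>\<close>.\<close>
  also have "\<dots> = (\<Sum>m\<le>n. of_nat (n choose m) * (R ^^ Suc m) \<phi> 0 * (Q ^^ (n - m)) \<psi> (\<lambda>_. 0)) +
      (\<Sum>m\<le>n. of_nat (n choose m) * (R ^^ m) \<phi> 0 * (Q ^^ Suc (n - m)) \<psi> (\<lambda>_. 0))"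
    using Suc.IH[OF mR bR Suc.prems(3,4)] Suc.IH[OF Suc.prems(1,2) mQ bQ] by (simp add: funpow_swap1)
  finally show ?case
    by (simp only: sum_choose_pascal[of n "\<lambda>m. (R ^^ m) \<phi> 0" "\<lambda>m. (Q ^^ m) \<psi> (\<lambda>_. 0)"])
qed

text \<open>The joint probability of two events comes out as a constant times a function of the
  first times a function of the second, and such a factorization forces independence. The second
  component is a whole sequence of sums, because independence will be needed from all observed
  entries of a row together.\<close>

lemma thinning_indep:
  fixes u :: "'e \<Rightarrow> real" and c :: "'e \<Rightarrow> nat \<Rightarrow> real"
  assumes u[measurable]: "u \<in> borel_measurable E" and c[measurable]: "c \<in> measurable E (PiM UNIV (\<lambda>_. borel))"
    and A[measurable]: "A \<in> sets E"
    and uA: "\<And>e. e \<in> A \<Longrightarrow> u e = 0" and cA: "\<And>e. e \<in> space E \<Longrightarrow> e \<notin> A \<Longrightarrow> c e = (\<lambda>_. 0)"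
  shows "indep_pair borel (\<lambda>\<omega>. S u (N \<omega>) \<omega>) (PiM UNIV (\<lambda>_. borel)) (\<lambda>\<omega>. V c (N \<omega>) \<omega>)"
proof -
  interpret nu: prob_space \<nu> by (rule prob_space_nu)
  let ?P = "PiM UNIV (\<lambda>_::nat. borel :: real measure)"
  let ?U = "\<lambda>\<omega>. S u (N \<omega>) \<omega>" and ?V = "\<lambda>\<omega>. V c (N \<omega>) \<omega>"
  have mU[measurable]: "?U \<in> borel_measurable M" by measurable
  have mV[measurable]: "?V \<in> measurable M ?P"
    by (rule measurable_compose_countable) auto
  define R where "R = (\<lambda>(\<phi> :: real \<Rightarrow> real) x. \<integral>e. indicator (space E - A) e * \<phi> (x + u e) \<partial>\<nu>)"
  define Q where "Q = (\<lambda>(\<psi> :: (nat \<Rightarrow> real) \<Rightarrow> real) y. \<integral>e. indicator A e * \<psi> (\<lambda>t. y t + c e t) \<partial>\<nu>)"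
  define r where "r G = (\<Sum>m. \<mu> ^ m / fact m * (R ^^ m) (indicator G) 0)" for G
  define q where "q B = (\<Sum>m. \<mu> ^ m / fact m * (Q ^^ m) (indicator B) (\<lambda>_. 0))" for B

  have ind_le: "\<bar>indicator G x\<bar> \<le> (1::real)" for G :: "'z set" and x
    by (simp add: indicator_def)
  have ct[measurable]: "(\<lambda>e. c e t) \<in> borel_measurable E" for t
    using measurable_compose[OF c measurable_component_singleton[of t UNIV "\<lambda>_. borel"]] by simp
  have indN: "indep_pair (count_space UNIV) N (borel \<Otimes>\<^sub>M ?P) (\<lambda>\<omega>. (S u n \<omega>, V c n \<omega>))" for n
  proof (rule N_indep_of_points)
    show "(\<lambda>x. (\<Sum>k = 1..n. u (x k), \<lambda>t. \<Sum>k = 1..n. c (x k) t)) \<in> measurable (PiM {1..n} (\<lambda>_. E)) (borel \<Otimes>\<^sub>M ?P)"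
      by (intro measurable_Pair partial_sum_meas u measurable_PiM_single') (auto intro: partial_sum_meas[OF ct])
  qed (simp add: S_def V_def)
  \<comment> \<open>For a non-integrable f the integral is 0 by convention, so the iterates of R and
    Q can be bounded without a proof that they are measurable.\<close>
  have int_le: "\<bar>\<integral>e. f e \<partial>\<nu>\<bar> \<le> 1" if "\<And>e. \<bar>f e\<bar> \<le> (1::real)" for f
  proof (cases "integrable \<nu> f")
    case True
    then have "\<bar>\<integral>e. f e \<partial>\<nu>\<bar> \<le> (\<integral>e. 1 \<partial>\<nu>)"
      using that by (intro order_trans[OF integral_abs_bound] integral_mono) auto
    then show ?thesis by (simp add: nu.prob_space)
  qed (simp add: not_integrable_integral_eq)
  have bdR: "\<bar>(R ^^ m) \<phi> x\<bar> \<le> 1" if "\<And>x. \<bar>\<phi> x\<bar> \<le> 1" for m \<phi> x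
    using that
  proof (induction m arbitrary: x)
    case (Suc m)
    then show ?case
      by (auto simp: R_def indicator_def intro!: int_le)
  qed simp
  have bdQ: "\<bar>(Q ^^ m) \<psi> y\<bar> \<le> 1" if "\<And>y. \<bar>\<psi> y\<bar> \<le> 1" for m \<psi> y
    using that
  proof (induction m arbitrary: y)
    case (Suc m)
    then show ?case
      by (auto simp: Q_def indicator_def intro!: int_le)
  qed simp
  have summ: "summable (\<lambda>m. norm (\<mu> ^ m / fact m * a m))" if "\<And>m. \<bar>a m\<bar> \<le> 1" for a :: "nat \<Rightarrow> real"
  proof (rule summable_comparison_test')
    show "summable (\<lambda>m. \<mu> ^ m / fact m)"
      using summable_exp[of \<mu>] by (simp add: field_simps)
    show "norm (norm (\<mu> ^ m / fact m * a m)) \<le> \<mu> ^ m / fact m" for m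
      using mult_left_mono[OF that[of m], of "\<mu> ^ m / fact m"] mu_nonneg by (simp add: abs_mult)
  qed
  have joint: "prob {\<omega> \<in> space M. ?U \<omega> \<in> G \<and> ?V \<omega> \<in> B} = exp (- \<mu>) * (r G * q B)"
    if [measurable]: "G \<in> sets borel" "B \<in> sets ?P" for G B
  proof -
    have e: "expectation (\<lambda>\<omega>. indicator G (S u n \<omega>) * indicator B (V c n \<omega>)) =
      (\<Sum>m\<le>n. of_nat (n choose m) * (R ^^ m) (indicator G) 0 * (Q ^^ (n - m)) (indicator B) (\<lambda>_. 0))" for n
      unfolding R_def Q_def
      by (intro thinned_expectation_binomial u c A uA cA ind_le) measurable
    have ind2: "indep_pair (count_space UNIV) N borel (\<lambda>\<omega>. indicator G (S u n \<omega>) * indicator B (V c n \<omega>) :: real)" for n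
    proof -
      have "(\<lambda>p. indicator G (fst p) * indicator B (snd p) :: real) \<in> borel_measurable (borel \<Otimes>\<^sub>M ?P)"
        by measurable
      from indep_pair_compose[OF indN[of n] measurable_ident this] show ?thesis
        by simp
    qed
    have int2: "integrable M (\<lambda>\<omega>. indicator G (S u n \<omega>) * indicator B (V c n \<omega>) :: real)" for n
      by (rule integrable_const_bound[where B=1]) (auto simp: indicator_def)
    have "norm (expectation (\<lambda>\<omega>. norm (indicator G (S u n \<omega>) * indicator B (V c n \<omega>) :: real))) \<le> 1" for n
    proof -
      have "expectation (\<lambda>\<omega>. norm (indicator G (S u n \<omega>) * indicator B (V c n \<omega>) :: real)) \<le> expectation (\<lambda>_. 1)"
        by (intro integral_mono integrable_norm int2) (auto simp: indicator_def)
      then show ?thesis by (simp add: prob_space)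
    qed
    from random_index_sums[OF ind2 int2 N_summable_bounded[OF this]]
    have "(\<lambda>n. prob {\<omega> \<in> space M. N \<omega> = n} * expectation (\<lambda>\<omega>. indicator G (S u n \<omega>) * indicator B (V c n \<omega>)))
        sums expectation (\<lambda>\<omega>. indicator G (?U \<omega>) * indicator B (?V \<omega>) :: real)"
      by simp
    \<comment> \<open>The n! of the binomial coefficient cancels that of the Poisson weight, and
      \<mu>^n splits as \<mu>^m times \<mu>^(n - m).\<close>
    moreover have "prob {\<omega> \<in> space M. N \<omega> = n} * expectation (\<lambda>\<omega>. indicator G (S u n \<omega>) * indicator B (V c n \<omega>)) =
        exp (- \<mu>) * (\<Sum>m\<le>n. (\<mu> ^ m / fact m * (R ^^ m) (indicator G) 0) *
          (\<mu> ^ (n - m) / fact (n - m) * (Q ^^ (n - m)) (indicator B) (\<lambda>_. 0)))" for n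
      unfolding e N_poisson sum_distrib_left
    proof (intro sum.cong refl)
      fix m assume "m \<in> {..n}"
      then have m: "m \<le> n" by simp
      have "\<mu> ^ n = \<mu> ^ m * \<mu> ^ (n - m)" using m by (simp flip: power_add)
      then show "\<mu> ^ n / fact n * exp (- \<mu>) *
          (real (n choose m) * (R ^^ m) (indicator G) 0 * (Q ^^ (n - m)) (indicator B) (\<lambda>_. 0)) =
          exp (- \<mu>) * (\<mu> ^ m / fact m * (R ^^ m) (indicator G) 0 *
            (\<mu> ^ (n - m) / fact (n - m) * (Q ^^ (n - m)) (indicator B) (\<lambda>_. 0)))"
        using m by (simp add: binomial_fact field_simps)
    qed
    moreover have "(\<lambda>n. exp (- \<mu>) * (\<Sum>m\<le>n. (\<mu> ^ m / fact m * (R ^^ m) (indicator G) 0) *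
          (\<mu> ^ (n - m) / fact (n - m) * (Q ^^ (n - m)) (indicator B) (\<lambda>_. 0)))) sums (exp (- \<mu>) * (r G * q B))"
      unfolding r_def q_def by (intro sums_mult Cauchy_product_sums summ bdR bdQ ind_le)
    moreover have "expectation (\<lambda>\<omega>. indicator G (?U \<omega>) * indicator B (?V \<omega>) :: real) = prob {\<omega> \<in> space M. ?U \<omega> \<in> G \<and> ?V \<omega> \<in> B}"
    proof -
      have "expectation (\<lambda>\<omega>. indicator G (?U \<omega>) * indicator B (?V \<omega>) :: real) =
          expectation (indicator {\<omega> \<in> space M. ?U \<omega> \<in> G \<and> ?V \<omega> \<in> B})"
        by (intro Bochner_Integration.integral_cong) (auto simp: indicator_def)
      then show ?thesis by simp
    qed
    ultimately show ?thesis
      using sums_unique2 by fastforce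
  qed
  show ?thesis
    unfolding indep_pair_iff_prob
  proof (intro conjI ballI mU mV)
    fix G B assume G: "G \<in> sets (borel :: real measure)" and B: "B \<in> sets ?P"
    have P: "UNIV \<in> sets ?P"
      using sets.top[of ?P] by (simp add: space_PiM)
    \<comment> \<open>The factors r and q are not normalized. Taking the full space in one or both
      places gives the margins and the total mass, and the surplus constants multiply to 1.\<close>
    have 1: "1 = exp (- \<mu>) * (r UNIV * q UNIV)"
      using joint[OF _ P, of UNIV] by (simp add: prob_space)
    have 2: "prob {\<omega> \<in> space M. ?U \<omega> \<in> G} = exp (- \<mu>) * (r G * q UNIV)"
      using joint[OF G P] by simp
    have 3: "prob {\<omega> \<in> space M. ?V \<omega> \<in> B} = exp (- \<mu>) * (r UNIV * q B)"
      using joint[OF _ B, of UNIV] by simp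
    have "exp (- \<mu>) * (r G * q UNIV) * (exp (- \<mu>) * (r UNIV * q B)) =
        (exp (- \<mu>) * (r UNIV * q UNIV)) * (exp (- \<mu>) * (r G * q B))" by (simp add: algebra_simps)
    then show "prob {\<omega> \<in> space M. ?U \<omega> \<in> G \<and> ?V \<omega> \<in> B} =
        prob {\<omega> \<in> space M. ?U \<omega> \<in> G} * prob {\<omega> \<in> space M. ?V \<omega> \<in> B}"
      unfolding 2 3 joint[OF G B] by (simp flip: 1)
  qed
qed

end

section \<open>Convergence in distribution\<close>

text \<open>The extended continuous mapping theorem, for maps that change with n. Skorohod's
  representation replaces convergence in distribution by pointwise convergence, where
  \<open>hk\<close> applies to each path; bounded continuous test functions then pass to the limit
  by dominated convergence.\<close>

lemma weak_conv_m_continuous_family: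
  fixes h :: "nat \<Rightarrow> real \<Rightarrow> real"
  assumes \<mu>: "\<And>n. real_distribution (\<mu> n)" and L: "real_distribution L"
    and conv: "weak_conv_m \<mu> L"
    and h[measurable]: "\<And>n. h n \<in> borel_measurable borel" "k \<in> borel_measurable borel"
    and hk: "\<And>x xs. xs \<longlonglongrightarrow> x \<Longrightarrow> (\<lambda>n. h n (xs n)) \<longlonglongrightarrow> k x"
  shows "weak_conv_m (\<lambda>n. distr (\<mu> n) borel (h n)) (distr L borel k)"
proof -
  obtain \<Omega> :: "real measure" and Y :: "nat \<Rightarrow> real \<Rightarrow> real" and Y' where
    "prob_space \<Omega>" and Y[measurable]: "\<And>n. Y n \<in> borel_measurable \<Omega>"
    and dY: "\<And>n. distr \<Omega> borel (Y n) = \<mu> n"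
    and Y'[measurable]: "Y' \<in> borel_measurable \<Omega>" and dY': "distr \<Omega> borel Y' = L"
    and lim: "\<And>x. x \<in> space \<Omega> \<Longrightarrow> (\<lambda>n. Y n x) \<longlonglongrightarrow> Y' x"
    using Skorohod[OF \<mu> L conv] by force
  interpret \<Omega>: prob_space \<Omega> by fact
  interpret \<mu>: real_distribution "\<mu> n" for n by (rule \<mu>)
  interpret L: real_distribution L by (rule L)
  have [measurable]: "h n \<in> borel_measurable (\<mu> m)" "k \<in> borel_measurable L" for n m
    by simp_all
  interpret a: real_distribution "distr (\<mu> n) borel (h n)" for n
    by (rule \<mu>.real_distribution_distr) simp
  interpret b: real_distribution "distr L borel k"
    by (rule L.real_distribution_distr) simp
  show ?thesis
  proof (rule integral_bdd_continuous_conv_imp_weak_conv)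
    fix f :: "real \<Rightarrow> real"
    assume c: "\<And>x. isCont f x" and bd: "\<And>x. \<bar>f x\<bar> \<le> 1"
    have [measurable]: "f \<in> borel_measurable borel"
      using c by (intro borel_measurable_continuous_onI continuous_at_imp_continuous_on) auto
    have "(\<lambda>n. \<integral>x. f (h n (Y n x)) \<partial>\<Omega>) \<longlonglongrightarrow> (\<integral>x. f (k (Y' x)) \<partial>\<Omega>)"
    proof (rule integral_dominated_convergence[where w="\<lambda>_. 1"])
      show "AE x in \<Omega>. (\<lambda>n. f (h n (Y n x))) \<longlonglongrightarrow> f (k (Y' x))"
        by (intro AE_I2 isCont_tendsto_compose[OF c] hk lim)
    qed (use bd in auto)
    moreover have "(\<integral>x. f (h n (Y n x)) \<partial>\<Omega>) = integral\<^sup>L (distr (\<mu> n) borel (h n)) f" for n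
      by (simp add: dY[symmetric] integral_distr)
    moreover have "(\<integral>x. f (k (Y' x)) \<partial>\<Omega>) = integral\<^sup>L (distr L borel k) f"
      by (simp add: dY'[symmetric] integral_distr)
    ultimately show "(\<lambda>n. integral\<^sup>L (distr (\<mu> n) borel (h n)) f) \<longlonglongrightarrow> integral\<^sup>L (distr L borel k) f"
      by simp
  qed (intro a.real_distribution_axioms b.real_distribution_axioms)+
qed

text \<open>The exponent of the compound Poisson characteristic function is linear in that of a
  mark, so a second order expansion inside the exponent suffices and no power has to be expanded.
  The scale uses the raw second moment s because the variance of the sum is \<mu> s.\<close>

lemma compound_poisson_clt:
  fixes L :: "nat \<Rightarrow> real measure" and \<rho> :: "real measure" and \<mu> :: "nat \<Rightarrow> real"
  assumes L: "\<And>n. real_distribution (L n)" and \<rho>: "real_distribution \<rho>"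
    and sq: "integrable \<rho> (\<lambda>x. x\<^sup>2)"
    and m: "(\<integral>x. x \<partial>\<rho>) = m" and s: "(\<integral>x. x\<^sup>2 \<partial>\<rho>) = s" and s_pos: "0 < s"
    and char_L: "\<And>n t. char (L n) t = exp (of_real (\<mu> n) * (char \<rho> t - 1))"
    and \<mu>_pos: "\<And>n. 0 < \<mu> n" and \<mu>: "filterlim \<mu> at_top sequentially"
  shows "weak_conv_m (\<lambda>n. distr (L n) borel (\<lambda>x. (x - \<mu> n * m) / sqrt (\<mu> n * s))) std_normal_distribution"
proof (rule levy_continuity)
  interpret L: real_distribution "L n" for n by (rule L)
  interpret \<rho>: real_distribution \<rho> by (rule \<rho>)
  show "real_distribution (distr (L n) borel (\<lambda>x. (x - \<mu> n * m) / sqrt (\<mu> n * s)))" for n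
    by (rule L.real_distribution_distr) simp
  show "real_distribution std_normal_distribution" by (rule real_dist_normal_dist)
  fix t :: real
  \<comment> \<open>The argument after rescaling; \<mu> \<tau>^2 is constant in n, so the quadratic
    term survives while \<tau> itself tends to 0.\<close>
  define \<tau> where "\<tau> n = t / sqrt (\<mu> n * s)" for n
  have i1: "integrable \<rho> (\<lambda>x. x)"
    by (rule \<rho>.square_integrable_imp_integrable[OF _ sq]) simp
  have sqm: "sqrt (\<mu> n * s) > 0" for n using \<mu>_pos s_pos by simp
  have \<tau>2: "\<mu> n * (\<tau> n)\<^sup>2 = t\<^sup>2 / s" for n
    using \<mu>_pos[of n] s_pos by (simp add: \<tau>_def power_divide)
  have char: "char (distr (L n) borel (\<lambda>x. (x - \<mu> n * m) / sqrt (\<mu> n * s))) t =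
      exp (of_real (\<mu> n) * (char \<rho> (\<tau> n) - 1 - \<i> * of_real (\<tau> n * m)))" for n
  proof -
    have "char (distr (L n) borel (\<lambda>x. (x - \<mu> n * m) / sqrt (\<mu> n * s))) t =
        (CLINT x|L n. iexp (t * ((x - \<mu> n * m) / sqrt (\<mu> n * s))))"
      unfolding char_def by (subst integral_distr) auto
    also have "\<dots> = (CLINT x|L n. iexp (- (\<tau> n * \<mu> n * m)) * iexp (\<tau> n * x))"
      by (intro Bochner_Integration.integral_cong refl)
         (simp add: exp_add[symmetric] \<tau>_def algebra_simps diff_divide_distrib)
    also have "\<dots> = iexp (- (\<tau> n * \<mu> n * m)) * char (L n) (\<tau> n)"
      unfolding char_def by simp
    also have "\<dots> = exp (of_real (\<mu> n) * (char \<rho> (\<tau> n) - 1 - \<i> * of_real (\<tau> n * m)))"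
      unfolding char_L exp_add[symmetric] by (simp add: algebra_simps)
    finally show ?thesis .
  qed
  \<comment> \<open>The remainder of the second order expansion. Its cubic branch tends to 0 with
    \<tau>, and its quadratic branch supplies an integrable majorant although third moments may be
    infinite.\<close>
  define \<epsilon> where "\<epsilon> n = (\<integral>x. min (6 * x\<^sup>2) (\<bar>\<tau> n\<bar> * \<bar>x\<bar> ^ 3) \<partial>\<rho>)" for n
  have bound: "cmod (of_real (\<mu> n) * (char \<rho> (\<tau> n) - 1 - \<i> * of_real (\<tau> n * m)) - of_real (- (t\<^sup>2) / 2)) \<le> t\<^sup>2 / (6 * s) * \<epsilon> n" for n
  proof -
    have "integrable \<rho> (\<lambda>x. x ^ k)" if "k \<le> 2" for k
    proof -
      have "k = 0 \<or> k = 1 \<or> k = 2" using that by auto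
      then show ?thesis using i1 sq by auto
    qed
    note approx = \<rho>.char_approx2[OF this, of 2 "\<tau> n"]
    have "(\<Sum>k\<le>2. ((\<i> * \<tau> n) ^ k / fact k) * (\<integral>x. x ^ k \<partial>\<rho>)) = 1 + \<i> * \<tau> n * m - (\<tau> n)\<^sup>2 * s / 2"
      by (simp add: atMost_nat_numeral m s \<rho>.prob_space[unfolded \<rho>.space_eq_univ] power_mult_distrib)
    moreover have "\<bar>\<tau> n\<bar> ^ 2 / fact (Suc 2) * (\<integral>x. min (2 * \<bar>x\<bar> ^ 2 * Suc 2) (\<bar>\<tau> n\<bar> * \<bar>x\<bar> ^ Suc 2) \<partial>\<rho>) = (\<tau> n)\<^sup>2 / 6 * \<epsilon> n"
      unfolding \<epsilon>_def by (simp add: fact_numeral mult.commute numeral_3_eq_3[symmetric])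
    ultimately have a: "cmod (char \<rho> (\<tau> n) - (1 + \<i> * \<tau> n * m - (\<tau> n)\<^sup>2 * s / 2)) \<le> (\<tau> n)\<^sup>2 / 6 * \<epsilon> n"
      using approx by (auto simp: fact_numeral)
    have "of_real (\<mu> n) * (char \<rho> (\<tau> n) - 1 - \<i> * of_real (\<tau> n * m)) - of_real (- (t\<^sup>2) / 2) =
      of_real (\<mu> n) * (char \<rho> (\<tau> n) - (1 + \<i> * \<tau> n * m - (\<tau> n)\<^sup>2 * s / 2))"
    proof -
      have "t\<^sup>2 / 2 = \<mu> n * ((\<tau> n)\<^sup>2 * s / 2)" using \<tau>2[of n] s_pos by (simp add: field_simps)
      then have "of_real (- (t\<^sup>2) / 2) = - (of_real (\<mu> n) * (of_real ((\<tau> n)\<^sup>2 * s / 2)) :: complex)"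
        by (metis minus_divide_left of_real_minus of_real_mult)
      then show ?thesis by (simp add: algebra_simps)
    qed
    then have "cmod (of_real (\<mu> n) * (char \<rho> (\<tau> n) - 1 - \<i> * of_real (\<tau> n * m)) - of_real (- (t\<^sup>2) / 2)) \<le>
       \<mu> n * ((\<tau> n)\<^sup>2 / 6 * \<epsilon> n)"
      using mult_left_mono[OF a, of "\<mu> n"] \<mu>_pos[of n] by (simp add: norm_mult)
    also have "\<dots> = (\<mu> n * (\<tau> n)\<^sup>2) / 6 * \<epsilon> n" by simp
    finally show ?thesis unfolding \<tau>2 by (simp add: mult.commute)
  qed
  have \<tau>0: "\<tau> \<longlonglongrightarrow> 0"
    unfolding \<tau>_def using s_pos
    by (intro tendsto_divide_0[OF tendsto_const] filterlim_at_top_imp_at_infinity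
         filterlim_compose[OF sqrt_at_top] filterlim_at_top_mult_tendsto_pos[OF tendsto_const _ \<mu>])
  have "\<epsilon> \<longlonglongrightarrow> (\<integral>x. 0 \<partial>\<rho>)"
    unfolding \<epsilon>_def
  proof (rule integral_dominated_convergence[where w="\<lambda>x. 6 * x\<^sup>2"])
    show "AE x in \<rho>. (\<lambda>n. min (6 * x\<^sup>2) (\<bar>\<tau> n\<bar> * \<bar>x\<bar> ^ 3)) \<longlonglongrightarrow> 0"
    proof (rule AE_I2)
      fix x :: real
      have "(\<lambda>n. min (6 * x\<^sup>2) (\<bar>\<tau> n\<bar> * \<bar>x\<bar> ^ 3)) \<longlonglongrightarrow> min (6 * x\<^sup>2) (\<bar>0\<bar> * \<bar>x\<bar> ^ 3)"
        by (intro tendsto_intros \<tau>0)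
      moreover have "min (6 * x\<^sup>2) (\<bar>0\<bar> * \<bar>x\<bar> ^ 3) = 0" by (simp add: min_absorb2)
      ultimately show "(\<lambda>n. min (6 * x\<^sup>2) (\<bar>\<tau> n\<bar> * \<bar>x\<bar> ^ 3)) \<longlonglongrightarrow> 0" by (simp only:)
    qed
  qed (use sq in auto)
  then have "(\<lambda>n. t\<^sup>2 / (6 * s) * \<epsilon> n) \<longlonglongrightarrow> 0"
    by (intro tendsto_mult_right_zero) simp
  then have "(\<lambda>n. of_real (\<mu> n) * (char \<rho> (\<tau> n) - 1 - \<i> * of_real (\<tau> n * m)) - of_real (- (t\<^sup>2) / 2)) \<longlonglongrightarrow> 0"
    by (rule Lim_null_comparison[rotated]) (use bound in auto)
  then have "(\<lambda>n. of_real (\<mu> n) * (char \<rho> (\<tau> n) - 1 - \<i> * of_real (\<tau> n * m))) \<longlonglongrightarrow> of_real (- (t\<^sup>2) / 2)"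
    by (rule LIM_zero_cancel)
  from tendsto_exp[OF this]
  show "(\<lambda>n. char (distr (L n) borel (\<lambda>x. (x - \<mu> n * m) / sqrt (\<mu> n * s))) t) \<longlonglongrightarrow> char std_normal_distribution t"
    unfolding char char_std_normal_distribution by (simp add: exp_of_real[symmetric])
qed

lemma conv_distr_at_topI:
  assumes "\<And>X. (\<And>n. 0 < X n) \<Longrightarrow> filterlim X at_top sequentially \<Longrightarrow> weak_conv_m (\<lambda>n. Ms (X n)) L"
  shows "conv_distr_at_top Ms L"
  unfolding conv_distr_at_top_def
proof (intro allI impI)
  fix x assume x: "isCont (cdf L) x"
  show "((\<lambda>a. cdf (Ms a) x) \<longlongrightarrow> cdf L x) at_top"
  proof (rule tendsto_at_topI_sequentially)
    fix X :: "nat \<Rightarrow> real" assume X: "filterlim X at_top sequentially"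
    let ?Y = "\<lambda>n. max (X n) 1"
    have ev: "eventually (\<lambda>n. ?Y n = X n) sequentially"
      using filterlim_at_top_dense[THEN iffD1, OF X, rule_format, of 1] by eventually_elim auto
    have "filterlim ?Y at_top sequentially"
      by (rule filterlim_cong[THEN iffD2, OF refl refl ev X])
    then have "weak_conv_m (\<lambda>n. Ms (?Y n)) L"
      by (intro assms) auto
    then have "(\<lambda>n. cdf (Ms (?Y n)) x) \<longlonglongrightarrow> cdf L x"
      using x by (auto simp: weak_conv_m_def weak_conv_def)
    moreover have "eventually (\<lambda>n. cdf (Ms (?Y n)) x = cdf (Ms (X n)) x) sequentially"
      using ev by eventually_elim simp
    ultimately show "(\<lambda>n. cdf (Ms (X n)) x) \<longlonglongrightarrow> cdf L x"
      by (rule Lim_transform_eventually)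
  qed
qed

lemma chi2_1_moments:
  shows prob_space_chi2_1: "prob_space chi2_1"
    and integrable_chi2_1: "integrable chi2_1 (\<lambda>x. x)"
    and expectation_chi2_1: "(\<integral>x. x \<partial>chi2_1) = 1"
proof -
  interpret real_distribution std_normal_distribution by (rule real_dist_normal_dist)
  show "prob_space chi2_1"
    unfolding chi2_1_def std_normal_def by (rule prob_space_distr) simp
  show "integrable chi2_1 (\<lambda>x. x)"
    unfolding chi2_1_def std_normal_def
    by (subst integrable_distr_eq) (auto simp: integrable_std_normal_distribution_moment)
  show "(\<integral>x. x \<partial>chi2_1) = 1"
    unfolding chi2_1_def std_normal_def
    using std_normal_distribution_even_moments[of 1] by (subst integral_distr) (auto simp: fact_numeral)
qed

section \<open>Telescoping of the development factors\<close>

lemma prod_ratio_telescope: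
  fixes p :: "nat \<Rightarrow> real"
  assumes "a \<le> b" "\<And>t. a \<le> t \<Longrightarrow> t \<le> b \<Longrightarrow> p t \<noteq> 0"
  shows "(\<Prod>s\<in>{a..<b}. p (s + 1) / p s) = p b / p a"
  using assms
proof (induction b rule: dec_induct)
  case (step n)
  then show ?case by (simp add: prod.atLeastLessThan_Suc)
qed simp

text \<open>The product before t is p t / p a and, as p T = 1, the squared product after t is 1 / p
  (t + 1)^2. Each summand thus becomes K / p a times (1 / p t - 1 / p (t + 1)), and with x = 1 / p a
  - 1 the total K (1 + x) x is the claimed value.\<close>

lemma development_sum:
  fixes p :: "nat \<Rightarrow> real"
  assumes le: "a \<le> T" and p: "\<And>t. a \<le> t \<Longrightarrow> t \<le> T \<Longrightarrow> 0 < p t" and pT: "p T = 1"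
  shows "(\<Sum>t\<in>{a..<T}. (\<Prod>s\<in>{a..<t}. p (s + 1) / p s) * ((p (t + 1) / p t - 1) * (p (t + 1) / p t) * K)
      * (\<Prod>s\<in>{Suc t..<T}. (p (s + 1) / p s)\<^sup>2)) = K * ((1 / p a - 1) + (1 / p a - 1)\<^sup>2)"
proof -
  have nz: "p t \<noteq> 0" if "a \<le> t" "t \<le> T" for t using p[OF that] by simp
  have term_eq: "(\<Prod>s\<in>{a..<t}. p (s + 1) / p s) * ((p (t + 1) / p t - 1) * (p (t + 1) / p t) * K)
      * (\<Prod>s\<in>{Suc t..<T}. (p (s + 1) / p s)\<^sup>2) = K / p a * (- 1 / p (Suc t) - - 1 / p t)" if t: "t \<in> {a..<T}" for t
  proof -
    have pa: "(\<Prod>s\<in>{a..<t}. p (s + 1) / p s) = p t / p a"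
      using t nz by (intro prod_ratio_telescope) auto
    have pb: "(\<Prod>s\<in>{Suc t..<T}. (p (s + 1) / p s)\<^sup>2) = (1 / p (Suc t))\<^sup>2"
      using t nz pT by (subst prod_power_distrib[symmetric], subst prod_ratio_telescope) auto
    show ?thesis
      unfolding pa pb using nz[of t] nz[of "Suc t"] nz[of a] t by (simp add: field_simps power2_eq_square)
  qed
  have "(\<Sum>t\<in>{a..<T}. K / p a * (- 1 / p (Suc t) - - 1 / p t)) = K / p a * (- 1 / p T - - 1 / p a)"
    unfolding sum_distrib_left[symmetric] by (subst sum_Suc_diff'[OF le]) simp
  also have "\<dots> = K * ((1 / p a - 1) + (1 / p a - 1)\<^sup>2)"
    using nz[of a] le pT by (simp add: field_simps power2_eq_square)
  finally show ?thesis using term_eq by simp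
qed

section \<open>The claims triangle\<close>

text \<open>Both identities undo the standardization of a deviation d with variance \<alpha> c: the
  first recovers the squared deviation over \<alpha>, the second the relative deviation that sits in
  the denominator of the quotient.\<close>

lemma sqrt_rescale:
  fixes c \<alpha> d :: real
  assumes "0 < c" "0 < \<alpha>"
  shows "c * (d / sqrt (\<alpha> * c))\<^sup>2 = d\<^sup>2 / \<alpha>" "sqrt c * (d / sqrt (\<alpha> * c)) / sqrt \<alpha> = d / \<alpha>"
proof -
  have "(sqrt (\<alpha> * c))\<^sup>2 = \<alpha> * c" using assms by (intro real_sqrt_pow2) simp
  then show "c * (d / sqrt (\<alpha> * c))\<^sup>2 = d\<^sup>2 / \<alpha>"
    using assms by (simp only: power_divide) simp
  have "sqrt c * (d / sqrt (\<alpha> * c)) / sqrt \<alpha> = d / (sqrt \<alpha> * sqrt \<alpha>)"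
    unfolding real_sqrt_mult using assms by simp
  then show "sqrt c * (d / sqrt (\<alpha> * c)) / sqrt \<alpha> = d / \<alpha>" using assms by simp
qed

text \<open>In \<open>indep\<close> the index (i, None) stands for the whole count process of row i
  and (i, Some k) for its k-th claim. One family thereby states independence across rows, of counts
  from claims, and among the claims.\<close>

locale poisson_triangle = prob_space M for M :: "'a measure" +
  fixes T :: nat and lam :: "nat \<Rightarrow> real"
    and N :: "nat \<Rightarrow> real \<Rightarrow> 'a \<Rightarrow> nat"
    and Dl :: "nat \<Rightarrow> nat \<Rightarrow> 'a \<Rightarrow> nat" and Zl :: "nat \<Rightarrow> nat \<Rightarrow> 'a \<Rightarrow> real"
    and D :: "'a \<Rightarrow> nat" and Z :: "'a \<Rightarrow> real"
  assumes T: "T \<ge> 2"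
    and lam_pos: "\<forall>i\<in>{1..T}. 0 < lam i"
    and pois: "\<forall>i\<in>{1..T}. poisson_process M (N i) (lam i)"
    and D_meas: "D \<in> measurable M (count_space UNIV)"
    and Z_meas: "Z \<in> borel_measurable M"
    and D_range: "\<forall>\<omega>\<in>space M. D \<omega> \<in> {1..T}"
    and DZ_indep: "indep_var borel (\<lambda>\<omega>. real (D \<omega>)) borel Z"
    and Z2_int: "integrable M (\<lambda>\<omega>. (Z \<omega>)\<^sup>2)"
    and EZD_pos: "\<forall>t\<in>{1..T}. 0 < (LINT \<omega>|M. Z \<omega> * indicator {\<omega>. D \<omega> = t} \<omega>)"
    and pairs_meas: "\<forall>i\<in>{1..T}. \<forall>k\<ge>1.
        (\<lambda>\<omega>. (Dl i k \<omega>, Zl i k \<omega>)) \<in> measurable M (count_space UNIV \<Otimes>\<^sub>M borel)"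
    and pairs_distr: "\<forall>i\<in>{1..T}. \<forall>k\<ge>1.
        distr M (count_space UNIV \<Otimes>\<^sub>M borel) (\<lambda>\<omega>. (Dl i k \<omega>, Zl i k \<omega>))
          = distr M (count_space UNIV \<Otimes>\<^sub>M borel) (\<lambda>\<omega>. (D \<omega>, Z \<omega>))"
    and indep: "indep_sets
        (\<lambda>(i, ko). case ko of
            None \<Rightarrow> gen_sets M (count_space UNIV) {N i a | a. 0 \<le> a}
          | Some k \<Rightarrow> gen_sets M (count_space UNIV \<Otimes>\<^sub>M borel) {\<lambda>\<omega>. (Dl i k \<omega>, Zl i k \<omega>)})
        ({1..T} \<times> (insert None (Some ` {1..})))"
begin

lemmas [measurable] = D_meas Z_meas

abbreviation E :: "(nat \<times> real) measure" where
  "E \<equiv> count_space UNIV \<Otimes>\<^sub>M borel"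

definition \<nu> :: "(nat \<times> real) measure" where
  "\<nu> = distr M E (\<lambda>\<omega>. (D \<omega>, Z \<omega>))"

definition p :: "nat \<Rightarrow> real" where
  "p t = prob {\<omega> \<in> space M. D \<omega> \<le> t}"

section \<open>The generic claim and the development factors\<close>

lemma Z_int: "integrable M Z"
  by (rule square_integrable_imp_integrable[OF Z_meas Z2_int])

text \<open>The hypothesis embeds D in the reals so that both variables share a type; rounding down
  inverts the embedding.\<close>

lemma D_Z_indep_pair: "indep_pair (count_space UNIV) D borel Z"
  using indep_pair_compose[OF DZ_indep[unfolded indep_var_iff_indep_pair], of "\<lambda>x. nat \<lfloor>x\<rfloor>" "count_space UNIV" "\<lambda>z. z" borel]
  by simp

lemma expectation_Z_D:
  assumes [measurable]: "h \<in> borel_measurable borel" and int: "integrable M (\<lambda>\<omega>. h (Z \<omega>))"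
  shows "expectation (\<lambda>\<omega>. h (Z \<omega>) * indicator {\<omega>. Q (D \<omega>)} \<omega>) = expectation (\<lambda>\<omega>. h (Z \<omega>)) * prob {\<omega> \<in> space M. Q (D \<omega>)}"
proof -
  have i: "integrable M (\<lambda>\<omega>. of_bool (Q (D \<omega>)) :: real)"
    by (rule integrable_const_bound[where B=1]) auto
  have "expectation (\<lambda>\<omega>. h (Z \<omega>) * indicator {\<omega>. Q (D \<omega>)} \<omega>) = expectation (\<lambda>\<omega>. of_bool (Q (D \<omega>)) * h (Z \<omega>))"
    by (intro Bochner_Integration.integral_cong) (auto simp: indicator_def)
  also have "\<dots> = expectation (\<lambda>\<omega>. of_bool (Q (D \<omega>))) * expectation (\<lambda>\<omega>. h (Z \<omega>))"
    by (rule indep_pair_integral_mult[OF D_Z_indep_pair, of "\<lambda>d. of_bool (Q d)" h]) (use i int in auto)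
  also have "expectation (\<lambda>\<omega>. of_bool (Q (D \<omega>))) = expectation (indicator {\<omega> \<in> space M. Q (D \<omega>)})"
    by (intro Bochner_Integration.integral_cong) (auto simp: indicator_def)
  finally show ?thesis by (simp add: mult.commute)
qed

lemma Z_moments_le:
  "expectation (\<lambda>\<omega>. Z \<omega> * indicator {\<omega>. D \<omega> \<le> t} \<omega>) = expectation Z * p t"
  "expectation (\<lambda>\<omega>. (Z \<omega>)\<^sup>2 * indicator {\<omega>. D \<omega> \<le> t} \<omega>) = expectation (\<lambda>\<omega>. (Z \<omega>)\<^sup>2) * p t"
  using expectation_Z_D[OF _ Z_int, of "\<lambda>d. d \<le> t"] expectation_Z_D[OF _ Z2_int, of "\<lambda>d. d \<le> t"]
  by (simp_all add: p_def)

lemma Z_moments_eq: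
  "expectation (\<lambda>\<omega>. Z \<omega> * indicator {\<omega>. D \<omega> = t} \<omega>) = expectation Z * prob {\<omega> \<in> space M. D \<omega> = t}"
  "expectation (\<lambda>\<omega>. (Z \<omega>)\<^sup>2 * indicator {\<omega>. D \<omega> = t} \<omega>) = expectation (\<lambda>\<omega>. (Z \<omega>)\<^sup>2) * prob {\<omega> \<in> space M. D \<omega> = t}"
  using expectation_Z_D[OF _ Z_int, of "\<lambda>d. d = t"] expectation_Z_D[OF _ Z2_int, of "\<lambda>d. d = t"]
  by simp_all

text \<open>The hypothesis gives positivity only of the product of E[Z] and P(D = t); since a
  probability is nonnegative, both factors are positive.\<close>

lemma EZ_prob_pos:
  assumes "t \<in> {1..T}"
  shows "0 < expectation Z" "0 < prob {\<omega> \<in> space M. D \<omega> = t}"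
proof -
  have "0 < expectation Z * prob {\<omega> \<in> space M. D \<omega> = t}"
    using EZD_pos assms unfolding Z_moments_eq by auto
  then show "0 < expectation Z" "0 < prob {\<omega> \<in> space M. D \<omega> = t}"
    using measure_nonneg[of M "{\<omega> \<in> space M. D \<omega> = t}"] by (auto simp: zero_less_mult_iff)
qed

lemma EZ_pos: "0 < expectation Z"
  using EZ_prob_pos(1)[of 1] T by simp

lemma EZ2_pos: "0 < expectation (\<lambda>\<omega>. (Z \<omega>)\<^sup>2)"
proof -
  have "0 \<le> variance Z" by (rule variance_positive)
  then have "(expectation Z)\<^sup>2 \<le> expectation (\<lambda>\<omega>. (Z \<omega>)\<^sup>2)"
    using variance_eq[OF Z_int Z2_int] by simp
  then show ?thesis using EZ_pos by (smt (verit) zero_less_power)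
qed

lemma p_pos: "1 \<le> t \<Longrightarrow> 0 < p t"
proof -
  assume "1 \<le> t"
  then have "prob {\<omega> \<in> space M. D \<omega> = 1} \<le> p t"
    unfolding p_def by (intro finite_measure_mono) auto
  then show ?thesis using EZ_prob_pos(2)[of 1] T by simp
qed

lemma p_T: "p T = 1"
proof -
  have "{\<omega> \<in> space M. D \<omega> \<le> T} = space M" using D_range by auto
  then show ?thesis by (simp add: p_def prob_space)
qed

lemma prob_D_gr: "prob {\<omega> \<in> space M. a < D \<omega>} = 1 - p a"
proof -
  have "{\<omega> \<in> space M. a < D \<omega>} = space M - {\<omega> \<in> space M. D \<omega> \<le> a}" by auto
  then show ?thesis unfolding p_def by (simp add: prob_compl)
qed

lemma dev_f_eq: "dev_f M D Z t = p (t + 1) / p t"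
  unfolding dev_f_def Z_moments_le using EZ_pos by simp

text \<open>By independence both quotients of moments collapse to E[Z^2] / E[Z], so the bracket is
  that constant times 1 + (f - 1) = f.\<close>

lemma dev_sigma2_eq:
  assumes "1 \<le> t" "t < T"
  shows "dev_sigma2 M D Z t = (p (t + 1) / p t - 1) * (p (t + 1) / p t) * (expectation (\<lambda>\<omega>. (Z \<omega>)\<^sup>2) / expectation Z)"
proof -
  have "prob {\<omega> \<in> space M. D \<omega> = t + 1} > 0" using EZ_prob_pos(2)[of "t + 1"] assms by simp
  moreover have "p t > 0" using p_pos assms by simp
  moreover have "(x - 1) * (k * q / (z * q) + (x - 1) * (k * r / (z * r))) = (x - 1) * x * (k / z)"
    if "q > 0" "r > 0" "z > 0" for q r z k x :: real
    using that by (simp add: field_simps)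
  ultimately show ?thesis
    unfolding dev_sigma2_def dev_f_eq Z_moments_le Z_moments_eq using EZ_pos by blast
qed

text \<open>This identifies g as the reciprocal of the probability that a claim of the row has been
  reported.\<close>

lemma dev_prod:
  assumes "1 \<le> a" "a \<le> T"
  shows "(\<Prod>s\<in>{a..<T}. dev_f M D Z s) = 1 / p a"
  unfolding dev_f_eq using assms p_pos p_T by (subst prod_ratio_telescope) (auto simp: less_imp_neq[symmetric])

lemma dev_sum:
  assumes "1 \<le> a" "a \<le> T"
  shows "(\<Sum>t\<in>{a..<T}. (\<Prod>s\<in>{a..<t}. dev_f M D Z s) * dev_sigma2 M D Z t * (\<Prod>s\<in>{Suc t..<T}. (dev_f M D Z s)\<^sup>2)) =
    expectation (\<lambda>\<omega>. (Z \<omega>)\<^sup>2) / expectation Z * ((1 / p a - 1) + (1 / p a - 1)\<^sup>2)"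
  unfolding dev_f_eq
  by (subst development_sum[symmetric]) (use assms p_pos p_T in \<open>auto simp: dev_sigma2_eq intro!: sum.cong\<close>)

section \<open>Law of the marks and independent sources\<close>

lemma integral_nu:
  assumes [measurable]: "w \<in> borel_measurable E"
  shows "(\<integral>e. (w e :: real) \<partial>\<nu>) = expectation (\<lambda>\<omega>. w (D \<omega>, Z \<omega>))"
    and "integrable \<nu> w \<longleftrightarrow> integrable M (\<lambda>\<omega>. w (D \<omega>, Z \<omega>))"
  unfolding \<nu>_def by (auto intro!: integral_distr integrable_distr_eq)

text \<open>Claim counts are padded with a zero so that counts and claims share one value type, as
  \<open>indep_vars\<close> demands.\<close>

definition source :: "real \<Rightarrow> nat \<times> nat option \<Rightarrow> 'a \<Rightarrow> nat \<times> real" where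
  "source \<alpha> = (\<lambda>(i, ko) \<omega>. case ko of None \<Rightarrow> (N i \<alpha> \<omega>, 0) | Some k \<Rightarrow> (Dl i k \<omega>, Zl i k \<omega>))"

lemma source_simps[simp]: "source \<alpha> (i, None) \<omega> = (N i \<alpha> \<omega>, 0)" "source \<alpha> (i, Some k) \<omega> = (Dl i k \<omega>, Zl i k \<omega>)"
  by (simp_all add: source_def)

lemma N_meas: "i \<in> {1..T} \<Longrightarrow> 0 \<le> \<alpha> \<Longrightarrow> N i \<alpha> \<in> measurable M (count_space UNIV)"
  using pois by (auto simp: poisson_process_def)

text \<open>At a fixed \<alpha> each source generates a subfamily of the corresponding sigma-algebra
  in \<open>indep\<close>, and independence passes to subfamilies.\<close>

lemma source_indep:
  assumes "0 < \<alpha>"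
  shows "indep_vars (\<lambda>_. E) (source \<alpha>) ({1..T} \<times> (insert None (Some ` {1..})))"
  unfolding indep_vars_def2
proof (intro conjI ballI)
  fix q :: "nat \<times> nat option" assume "q \<in> {1..T} \<times> (insert None (Some ` {1..}))"
  then show "random_variable E (source \<alpha> q)"
    using N_meas[of "fst q" \<alpha>] pairs_meas assms by (auto simp: source_def split: option.split intro!: measurable_Pair)
next
  show "indep_sets (\<lambda>q. {source \<alpha> q -` A \<inter> space M |A. A \<in> sets E}) ({1..T} \<times> (insert None (Some ` {1..})))"
  proof (rule indep_sets_mono_sets[OF indep])
    fix q :: "nat \<times> nat option" assume q: "q \<in> {1..T} \<times> (insert None (Some ` {1..}))"
    obtain i ko where [simp]: "q = (i, ko)" by (cases q)
    show "{source \<alpha> q -` A \<inter> space M |A. A \<in> sets E} \<subseteq>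
      (case q of (i, ko) \<Rightarrow> case ko of
            None \<Rightarrow> gen_sets M (count_space UNIV) {N i a | a. 0 \<le> a}
          | Some k \<Rightarrow> gen_sets M E {\<lambda>\<omega>. (Dl i k \<omega>, Zl i k \<omega>)})"
    proof (cases ko)
      case None
      have "source \<alpha> q -` A \<inter> space M \<in> gen_sets M (count_space UNIV) {N i a | a. 0 \<le> a}" for A
      proof -
        \<comment> \<open>The padding zero means that only the section of A at second component 0
          matters.\<close>
        have "source \<alpha> q -` A \<inter> space M = N i \<alpha> -` {n. (n, 0) \<in> A} \<inter> space M"
          by (auto simp: None)
        then show ?thesis
          unfolding gen_sets_def using assms
          by (intro sigma_sets.Basic CollectI exI[of _ "N i \<alpha>"] exI[of _ "{n. (n, 0) \<in> A}"]) auto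
      qed
      then show ?thesis by (auto simp: None)
    next
      case (Some k)
      have "source \<alpha> q -` A \<inter> space M \<in> gen_sets M E {\<lambda>\<omega>. (Dl i k \<omega>, Zl i k \<omega>)}" if "A \<in> sets E" for A
      proof -
        have "source \<alpha> q -` A \<inter> space M = (\<lambda>\<omega>. (Dl i k \<omega>, Zl i k \<omega>)) -` A \<inter> space M"
          by (auto simp: Some)
        then show ?thesis
          unfolding gen_sets_def using that by (intro sigma_sets.Basic) auto
      qed
      then show ?thesis by (auto simp: Some)
    qed
  qed
qed

lemma compound_poisson_row:
  assumes i: "i \<in> {1..T}" and \<alpha>: "0 < \<alpha>"
  shows "compound_poisson M (lam i * \<alpha>) (N i \<alpha>) E (\<lambda>k \<omega>. (Dl i k \<omega>, Zl i k \<omega>)) \<nu>"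
proof
  show "0 \<le> lam i * \<alpha>" using i \<alpha> lam_pos by (simp add: less_imp_le)
  show "prob {\<omega> \<in> space M. N i \<alpha> \<omega> = n} = (lam i * \<alpha>) ^ n / fact n * exp (- (lam i * \<alpha>))" for n
  proof -
    \<comment> \<open>The law of the count is the increment law started at time 0, where the process
      vanishes.\<close>
    have "prob {\<omega> \<in> space M. N i \<alpha> \<omega> - N i 0 \<omega> = n} = (lam i * (\<alpha> - 0)) ^ n / fact n * exp (- (lam i * (\<alpha> - 0)))"
    proof -
      have "poisson_process M (N i) (lam i)" using pois i by blast
      then show ?thesis
        unfolding poisson_process_def by (elim conjE allE[of _ 0] allE[of _ \<alpha>] allE[of _ n]) (use \<alpha> in simp)
    qed
    moreover have "{\<omega> \<in> space M. N i \<alpha> \<omega> - N i 0 \<omega> = n} = {\<omega> \<in> space M. N i \<alpha> \<omega> = n}"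
      using pois i by (auto simp: poisson_process_def)
    ultimately show ?thesis by simp
  qed
  show "distr M E (\<lambda>\<omega>. (Dl i k \<omega>, Zl i k \<omega>)) = \<nu>" if "1 \<le> k" for k
    using pairs_distr i that by (simp add: \<nu>_def)
  note ind = source_indep[OF \<alpha>]
  fix n
  \<comment> \<open>Disjoint blocks of sources are independent; the block is then reindexed from (i,
    Some k) to k.\<close>
  have "indep_pair (PiM ({i} \<times> Some ` {1..n}) (\<lambda>_. E)) (\<lambda>\<omega>. \<lambda>q\<in>{i} \<times> Some ` {1..n}. source \<alpha> q \<omega>)
      (PiM {(i, Some (Suc n))} (\<lambda>_. E)) (\<lambda>\<omega>. \<lambda>q\<in>{(i, Some (Suc n))}. source \<alpha> q \<omega>)"
    unfolding indep_var_iff_indep_pair[symmetric] using i by (intro indep_var_restrict[OF ind]) auto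
  from indep_pair_compose[OF this, of "\<lambda>x. \<lambda>k\<in>{1..n}. x (i, Some k)" "PiM {1..n} (\<lambda>_. E)" "\<lambda>x. x (i, Some (Suc n))" E]
  show "indep_pair (PiM {1..n} (\<lambda>_. E)) (\<lambda>\<omega>. \<lambda>k\<in>{1..n}. (Dl i k \<omega>, Zl i k \<omega>)) E (\<lambda>\<omega>. (Dl i (Suc n) \<omega>, Zl i (Suc n) \<omega>))"
    by (simp cong: restrict_cong)
  have "indep_pair (PiM {(i, None)} (\<lambda>_. E)) (\<lambda>\<omega>. \<lambda>q\<in>{(i, None)}. source \<alpha> q \<omega>)
      (PiM ({i} \<times> Some ` {1..n}) (\<lambda>_. E)) (\<lambda>\<omega>. \<lambda>q\<in>{i} \<times> Some ` {1..n}. source \<alpha> q \<omega>)"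
    unfolding indep_var_iff_indep_pair[symmetric] using i by (intro indep_var_restrict[OF ind]) auto
  from indep_pair_compose[OF this, of "\<lambda>x. fst (x (i, None))" "count_space UNIV" "\<lambda>x. \<lambda>k\<in>{1..n}. x (i, Some k)" "PiM {1..n} (\<lambda>_. E)"]
  show "indep_pair (count_space UNIV) (N i \<alpha>) (PiM {1..n} (\<lambda>_. E)) (\<lambda>\<omega>. \<lambda>k\<in>{1..n}. (Dl i k \<omega>, Zl i k \<omega>))"
    by (simp cong: restrict_cong)
qed

definition w :: "nat \<Rightarrow> nat \<times> real \<Rightarrow> real" where
  "w t e = snd e * (if fst e \<le> t then 1 else 0)"

lemma w_meas[measurable]: "w t \<in> borel_measurable E"
  unfolding w_def by measurable

lemma cum_eq_w: "cum N Dl Zl j t \<alpha> \<omega> = (\<Sum>k = 1..N j \<alpha> \<omega>. w t (Dl j k \<omega>, Zl j k \<omega>))"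
  by (simp add: cum_def w_def)

lemma w_nu:
  "integrable \<nu> (\<lambda>e. (w t e)\<^sup>2)" "integrable \<nu> (w t)"
  "(\<integral>e. w t e \<partial>\<nu>) = expectation Z * p t"
  "(\<integral>e. (w t e)\<^sup>2 \<partial>\<nu>) = expectation (\<lambda>\<omega>. (Z \<omega>)\<^sup>2) * p t"
proof -
  have m2: "(\<lambda>e. (w t e)\<^sup>2) \<in> borel_measurable E" by measurable
  have eq: "w t (D \<omega>, Z \<omega>) = Z \<omega> * indicator {\<omega>. D \<omega> \<le> t} \<omega>"
    "(w t (D \<omega>, Z \<omega>))\<^sup>2 = (Z \<omega>)\<^sup>2 * indicator {\<omega>. D \<omega> \<le> t} \<omega>" for \<omega>
    by (auto simp: w_def indicator_def)
  have "integrable M (\<lambda>\<omega>. (Z \<omega>)\<^sup>2 * indicator {\<omega>. D \<omega> \<le> t} \<omega>)"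
    by (rule Bochner_Integration.integrable_bound[OF Z2_int]) (auto simp: indicator_def)
  then show "integrable \<nu> (\<lambda>e. (w t e)\<^sup>2)" by (simp only: integral_nu(2)[OF m2] eq(2))
  have "integrable M (\<lambda>\<omega>. Z \<omega> * indicator {\<omega>. D \<omega> \<le> t} \<omega>)"
    by (rule Bochner_Integration.integrable_bound[OF Z_int]) (auto simp: indicator_def)
  then show "integrable \<nu> (w t)" by (subst integral_nu) (auto simp: eq)
  show "(\<integral>e. w t e \<partial>\<nu>) = expectation Z * p t"
    by (subst integral_nu) (auto simp: eq Z_moments_le)
  show "(\<integral>e. (w t e)\<^sup>2 \<partial>\<nu>) = expectation (\<lambda>\<omega>. (Z \<omega>)\<^sup>2) * p t"
    by (simp only: integral_nu(1)[OF m2] eq(2) Z_moments_le)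
qed

lemma w_diff_nu:
  assumes "a \<le> T"
  shows "integrable \<nu> (\<lambda>e. (w T e - w a e)\<^sup>2)"
    "(\<integral>e. w T e - w a e \<partial>\<nu>) = expectation Z * (1 - p a)"
    "(\<integral>e. (w T e - w a e)\<^sup>2 \<partial>\<nu>) = expectation (\<lambda>\<omega>. (Z \<omega>)\<^sup>2) * (1 - p a)"
proof -
  \<comment> \<open>As a \<le> T, the amount \<open>w a e\<close> is either 0 or equal to
    \<open>w T e\<close>, so the cross term is \<open>(w a e)\<close> squared and moments of the
    difference reduce to differences of moments.\<close>
  have eq: "(w T e - w a e)\<^sup>2 = (w T e)\<^sup>2 - (w a e)\<^sup>2" for e
    using assms by (auto simp: w_def)
  show "integrable \<nu> (\<lambda>e. (w T e - w a e)\<^sup>2)"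
    "(\<integral>e. w T e - w a e \<partial>\<nu>) = expectation Z * (1 - p a)"
    "(\<integral>e. (w T e - w a e)\<^sup>2 \<partial>\<nu>) = expectation (\<lambda>\<omega>. (Z \<omega>)\<^sup>2) * (1 - p a)"
    unfolding eq using w_nu[of T] w_nu[of a] by (auto simp: p_T algebra_simps)
qed

section \<open>Outstanding amount against the observed data\<close>

abbreviation vec_space :: "('i \<Rightarrow> real) measure" where
  "vec_space \<equiv> PiM UNIV (\<lambda>_. borel)"

text \<open>Entries beyond the diagonal are set to 0, so that a claim not yet reported contributes
  nothing to any coordinate; this is the vanishing condition of the thinning lemma.\<close>

definition observed_row :: "nat \<Rightarrow> real \<Rightarrow> 'a \<Rightarrow> nat \<Rightarrow> real" where
  "observed_row i \<alpha> \<omega> = (\<lambda>t. if t \<le> T - i + 1 then cum N Dl Zl i t \<alpha> \<omega> else 0)"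

text \<open>The other rows enter complete, including their unobserved entries: they are independent
  of row i anyway, and independence from more data is stronger.\<close>

definition other_rows :: "nat \<Rightarrow> real \<Rightarrow> 'a \<Rightarrow> nat \<times> nat \<Rightarrow> real" where
  "other_rows i \<alpha> \<omega> = (\<lambda>(j, t). if j \<in> {1..T} - {i} then cum N Dl Zl j t \<alpha> \<omega> else 0)"

definition outstanding :: "nat \<Rightarrow> real \<Rightarrow> 'a \<Rightarrow> real" where
  "outstanding i \<alpha> \<omega> = cum N Dl Zl i T \<alpha> \<omega> - cum N Dl Zl i (T - i + 1) \<alpha> \<omega>"

text \<open>The number of terms is itself a coordinate of the product space, with countably many
  values, so measurability is checked for each fixed number.\<close>

lemma random_sum_meas:
  assumes j: "j \<in> J" and [measurable]: "v \<in> borel_measurable E"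
  shows "(\<lambda>x. \<Sum>k = 1..fst (x (j, None)). v (x (j, Some k)) :: real) \<in>
    borel_measurable (PiM (J \<times> insert None (Some ` {1..})) (\<lambda>_. E))"
proof (rule measurable_compose_countable)
  show "(\<lambda>x. fst (x (j, None))) \<in> measurable (PiM (J \<times> insert None (Some ` {1::nat..})) (\<lambda>_. E)) (count_space UNIV)"
    using j by (intro measurable_compose[OF measurable_component_singleton[of "(j, None)" _ "\<lambda>_. E"] measurable_fst]) auto
  fix n :: nat
  show "(\<lambda>x. \<Sum>k = 1..n. v (x (j, Some k)) :: real) \<in> borel_measurable (PiM (J \<times> insert None (Some ` {1..})) (\<lambda>_. E))"
  proof (rule borel_measurable_sum[where f="\<lambda>k x. v (x (j, Some k))"])
    fix k assume "k \<in> {1..n}"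
    then show "(\<lambda>x. v (x (j, Some k))) \<in> borel_measurable (PiM (J \<times> insert None (Some ` {1..})) (\<lambda>_. E))"
      using j by (intro measurable_compose[OF measurable_component_singleton[of "(j, Some k)" _ "\<lambda>_. E"] assms(2)]) auto
  qed
qed

text \<open>Within row i this is thinning at the set of claims reported by T - i + 1. The pair of
  outstanding and observed amounts is a function of the sources of row i, hence independent of the
  remaining sources, and \<open>indep_pair_assoc\<close> regroups.\<close>

lemma outstanding_indep:
  assumes i: "i \<in> {1..T}" and \<alpha>: "0 < \<alpha>"
  shows "indep_pair borel (outstanding i \<alpha>) (vec_space \<Otimes>\<^sub>M vec_space) (\<lambda>\<omega>. (observed_row i \<alpha> \<omega>, other_rows i \<alpha> \<omega>))"
proof (rule indep_pair_assoc)
  let ?a = "T - i + 1"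
  \<comment> \<open>\<open>?u\<close> charges only claims reported after \<open>?a\<close>, and
    \<open>?c\<close> only those reported by then.\<close>
  let ?u = "\<lambda>e. w T e - w ?a e" and ?c = "\<lambda>e t. if t \<le> ?a then w t e else 0"
  interpret cp: compound_poisson M "lam i * \<alpha>" "N i \<alpha>" E "\<lambda>k \<omega>. (Dl i k \<omega>, Zl i k \<omega>)" \<nu>
    by (rule compound_poisson_row[OF i \<alpha>])
  have c: "?c \<in> measurable E vec_space"
    by (rule measurable_PiM_single') (auto intro: measurable_If)
  have row: "outstanding i \<alpha> \<omega> = cp.S ?u (N i \<alpha> \<omega>) \<omega>" "observed_row i \<alpha> \<omega> = cp.V ?c (N i \<alpha> \<omega>) \<omega>" for \<omega>
    by (auto simp: outstanding_def observed_row_def cp.S_def cp.V_def cum_eq_w sum_subtractf fun_eq_iff)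
  show "indep_pair borel (outstanding i \<alpha>) vec_space (observed_row i \<alpha>)"
    unfolding row[abs_def]
  proof (rule cp.thinning_indep)
    show "{e \<in> space E. fst e \<le> ?a} \<in> sets E" by measurable
    show "?u e = 0" if "e \<in> {e \<in> space E. fst e \<le> ?a}" for e
      using that i by (auto simp: w_def)
    show "?c e = (\<lambda>_. 0)" if "e \<in> space E" "e \<notin> {e \<in> space E. fst e \<le> ?a}" for e
      using that by (auto simp: w_def fun_eq_iff)
  qed (use c in auto)
  let ?R = "insert None (Some ` {1::nat..})"
  have "indep_pair (PiM ({i} \<times> ?R) (\<lambda>_. E)) (\<lambda>\<omega>. \<lambda>q\<in>{i} \<times> ?R. source \<alpha> q \<omega>)
      (PiM (({1..T} - {i}) \<times> ?R) (\<lambda>_. E)) (\<lambda>\<omega>. \<lambda>q\<in>({1..T} - {i}) \<times> ?R. source \<alpha> q \<omega>)"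
    unfolding indep_var_iff_indep_pair[symmetric] using i by (intro indep_var_restrict[OF source_indep[OF \<alpha>]]) auto
  moreover have "(\<lambda>x. (\<Sum>k = 1..fst (x (i, None)). ?u (x (i, Some k)),
        \<lambda>t. \<Sum>k = 1..fst (x (i, None)). ?c (x (i, Some k)) t)) \<in> measurable (PiM ({i} \<times> ?R) (\<lambda>_. E)) (borel \<Otimes>\<^sub>M vec_space)"
    by (intro measurable_Pair measurable_PiM_single' random_sum_meas) (auto intro!: measurable_If)
  moreover have "(\<lambda>x. \<lambda>(j, t). if j \<in> {1..T} - {i} then \<Sum>k = 1..fst (x (j, None)). w t (x (j, Some k)) else 0) \<in>
      measurable (PiM (({1..T} - {i}) \<times> ?R) (\<lambda>_. E)) vec_space"
  proof (rule measurable_PiM_single')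
    fix q :: "nat \<times> nat"
    show "(\<lambda>x. (\<lambda>(j, t). if j \<in> {1..T} - {i} then \<Sum>k = 1..fst (x (j, None)). w t (x (j, Some k)) else 0) q) \<in>
      borel_measurable (PiM (({1..T} - {i}) \<times> ?R) (\<lambda>_. E))"
    proof (cases "fst q \<in> {1..T} - {i}")
      case True
      from random_sum_meas[OF True w_meas[of "snd q"]] True show ?thesis
        by (simp add: case_prod_beta')
    qed (auto simp: case_prod_beta')
  qed auto
  ultimately have "indep_pair (borel \<Otimes>\<^sub>M vec_space)
      (\<lambda>\<omega>. (\<lambda>x. (\<Sum>k = 1..fst (x (i, None)). ?u (x (i, Some k)),
        \<lambda>t. \<Sum>k = 1..fst (x (i, None)). ?c (x (i, Some k)) t)) (\<lambda>q\<in>{i} \<times> ?R. source \<alpha> q \<omega>))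
      vec_space
      (\<lambda>\<omega>. (\<lambda>x. \<lambda>(j, t). if j \<in> {1..T} - {i} then \<Sum>k = 1..fst (x (j, None)). w t (x (j, Some k)) else 0)
        (\<lambda>q\<in>({1..T} - {i}) \<times> ?R. source \<alpha> q \<omega>))"
    by (rule indep_pair_compose)
  moreover have "(\<lambda>x. (\<Sum>k = 1..fst (x (i, None)). ?u (x (i, Some k)),
        \<lambda>t. \<Sum>k = 1..fst (x (i, None)). ?c (x (i, Some k)) t)) (\<lambda>q\<in>{i} \<times> ?R. source \<alpha> q \<omega>) =
      (outstanding i \<alpha> \<omega>, observed_row i \<alpha> \<omega>)" for \<omega>
    by (auto simp: row cp.S_def cp.V_def fun_eq_iff intro!: sum.cong)
  moreover have "(\<lambda>x. \<lambda>(j, t). if j \<in> {1..T} - {i} then \<Sum>k = 1..fst (x (j, None)). w t (x (j, Some k)) else 0)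
        (\<lambda>q\<in>({1..T} - {i}) \<times> ?R. source \<alpha> q \<omega>) = other_rows i \<alpha> \<omega>" for \<omega>
    by (auto simp: other_rows_def cum_eq_w fun_eq_iff)
  ultimately show "indep_pair (borel \<Otimes>\<^sub>M vec_space) (\<lambda>\<omega>. (outstanding i \<alpha> \<omega>, observed_row i \<alpha> \<omega>)) vec_space (other_rows i \<alpha>)"
    by simp
qed

section \<open>The sigma-algebra of the observed triangle\<close>

lemma cum_meas:
  assumes "j \<in> {1..T}" "0 < \<alpha>"
  shows "cum N Dl Zl j t \<alpha> \<in> borel_measurable M"
proof -
  interpret cp: compound_poisson M "lam j * \<alpha>" "N j \<alpha>" E "\<lambda>k \<omega>. (Dl j k \<omega>, Zl j k \<omega>)" \<nu>
    by (rule compound_poisson_row[OF assms])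
  have "cum N Dl Zl j t \<alpha> = (\<lambda>\<omega>. cp.S (w t) (N j \<alpha> \<omega>) \<omega>)"
    by (simp add: fun_eq_iff cum_eq_w cp.S_def)
  then show ?thesis by simp
qed

lemma triangle_alg_gens:
  "{cum N Dl Zl j t \<alpha> -` B \<inter> space M | j t B. j \<in> {1..T} \<and> t \<in> {1..T} \<and> j + t \<le> T + 1 \<and> B \<in> sets borel} \<subseteq> Pow (space M)"
  by auto

lemma subalgebra_triangle_alg:
  assumes "0 < \<alpha>"
  shows "subalgebra M (triangle_alg M T N Dl Zl \<alpha>)"
  unfolding subalgebra_def triangle_alg_def sets_measure_of[OF triangle_alg_gens] space_measure_of[OF triangle_alg_gens]
  using cum_meas[OF _ assms] by (intro conjI sets.sigma_sets_subset) (auto intro: measurable_sets)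

lemma cum_meas_triangle_alg:
  assumes "j \<in> {1..T}" "t \<in> {1..T}" "j + t \<le> T + 1"
  shows "cum N Dl Zl j t \<alpha> \<in> borel_measurable (triangle_alg M T N Dl Zl \<alpha>)"
proof (rule measurableI)
  fix B :: "real set" assume "B \<in> sets borel"
  then show "cum N Dl Zl j t \<alpha> -` B \<inter> space (triangle_alg M T N Dl Zl \<alpha>) \<in> sets (triangle_alg M T N Dl Zl \<alpha>)"
    unfolding triangle_alg_def sets_measure_of[OF triangle_alg_gens] space_measure_of[OF triangle_alg_gens]
    using assms by (intro sigma_sets.Basic) blast
qed simp

text \<open>Each generator is a preimage under one coordinate of the pair of vectors, so the
  triangle algebra lies in the algebra pulled back by that pair, whose members are exactly the
  preimages. This discharges \<open>gen\<close> in the conditional expectation lemmas.\<close>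

lemma triangle_alg_observed:
  assumes i: "i \<in> {1..T}" and A: "A \<in> sets (triangle_alg M T N Dl Zl \<alpha>)"
  shows "\<exists>K\<in>sets (vec_space \<Otimes>\<^sub>M vec_space). A = (\<lambda>\<omega>. (observed_row i \<alpha> \<omega>, other_rows i \<alpha> \<omega>)) -` K \<inter> space M"
proof -
  let ?W = "\<lambda>\<omega>. (observed_row i \<alpha> \<omega>, other_rows i \<alpha> \<omega>)" and ?P = "vec_space \<Otimes>\<^sub>M vec_space"
  let ?G = "vimage_algebra (space M) ?W ?P"
  have W: "?W \<in> space M \<rightarrow> space ?P" by (auto simp: space_pair_measure space_PiM)
  have "A \<in> sigma_sets (space M) {cum N Dl Zl j t \<alpha> -` B \<inter> space M | j t B.
      j \<in> {1..T} \<and> t \<in> {1..T} \<and> j + t \<le> T + 1 \<and> B \<in> sets borel}"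
    using A unfolding triangle_alg_def sets_measure_of[OF triangle_alg_gens] .
  also have "\<dots> \<subseteq> sets ?G"
  proof -
    have "cum N Dl Zl j t \<alpha> -` B \<inter> space M \<in> sets ?G"
      if "j \<in> {1..T}" "t \<in> {1..T}" "j + t \<le> T + 1" "B \<in> sets borel" for j t B
    proof -
      have "cum N Dl Zl j t \<alpha> \<in> borel_measurable ?G"
      proof (cases "j = i")
        case True
        have "(\<lambda>y. fst y t) \<in> borel_measurable ?P"
          by (rule measurable_compose[OF measurable_fst]) simp
        note measurable_compose[OF measurable_vimage_algebra1[OF W] this]
        \<comment> \<open>For j = i the condition j + t \<le> T + 1 says t \<le> T - i + 1, so the
          cutoff in \<open>observed_row\<close> is inactive.\<close>
        moreover have "cum N Dl Zl j t \<alpha> = (\<lambda>\<omega>. fst (?W \<omega>) t)"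
          using that True by (auto simp: observed_row_def)
        ultimately show ?thesis by (simp only:)
      next
        case False
        have "(\<lambda>y. snd y (j, t)) \<in> borel_measurable ?P"
          by (rule measurable_compose[OF measurable_snd]) simp
        note measurable_compose[OF measurable_vimage_algebra1[OF W] this]
        moreover have "cum N Dl Zl j t \<alpha> = (\<lambda>\<omega>. snd (?W \<omega>) (j, t))"
          using that False by (auto simp: other_rows_def)
        ultimately show ?thesis by (simp only:)
      qed
      from measurable_sets[OF this that(4)] show ?thesis by simp
    qed
    then have "{cum N Dl Zl j t \<alpha> -` B \<inter> space M | j t B.
      j \<in> {1..T} \<and> t \<in> {1..T} \<and> j + t \<le> T + 1 \<and> B \<in> sets borel} \<subseteq> sets ?G" by blast
    from sets.sigma_sets_subset[OF this] show ?thesis by simp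
  qed
  finally show ?thesis
    unfolding sets_vimage_algebra2[OF W] by auto
qed

section \<open>Moments of the row and the conditional squared error\<close>

lemma cum_moments:
  assumes i: "i \<in> {1..T}" and \<alpha>: "0 < \<alpha>"
  shows "expectation (cum N Dl Zl i t \<alpha>) = lam i * \<alpha> * (expectation Z * p t)"
    and "integrable M (\<lambda>\<omega>. (cum N Dl Zl i t \<alpha> \<omega>)\<^sup>2)"
proof -
  interpret cp: compound_poisson M "lam i * \<alpha>" "N i \<alpha>" E "\<lambda>k \<omega>. (Dl i k \<omega>, Zl i k \<omega>)" \<nu>
    by (rule compound_poisson_row[OF i \<alpha>])
  have eq: "cum N Dl Zl i t \<alpha> = (\<lambda>\<omega>. cp.S (w t) (N i \<alpha> \<omega>) \<omega>)"
    by (simp add: fun_eq_iff cum_eq_w cp.S_def)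
  show "expectation (cum N Dl Zl i t \<alpha>) = lam i * \<alpha> * (expectation Z * p t)"
    "integrable M (\<lambda>\<omega>. (cum N Dl Zl i t \<alpha> \<omega>)\<^sup>2)"
    unfolding eq by (simp_all add: cp.S_expectation cp.S_sq_integrable w_nu)
qed

lemma outstanding_moments:
  assumes i: "i \<in> {1..T}" and \<alpha>: "0 < \<alpha>"
  defines "a \<equiv> T - i + 1"
  shows "expectation (outstanding i \<alpha>) = lam i * \<alpha> * (expectation Z * (1 - p a))"
    and "integrable M (\<lambda>\<omega>. (outstanding i \<alpha> \<omega>)\<^sup>2)"
    and "expectation (\<lambda>\<omega>. (outstanding i \<alpha> \<omega>)\<^sup>2) =
      lam i * \<alpha> * (expectation (\<lambda>\<omega>. (Z \<omega>)\<^sup>2) * (1 - p a)) + (lam i * \<alpha> * (expectation Z * (1 - p a)))\<^sup>2"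
proof -
  interpret cp: compound_poisson M "lam i * \<alpha>" "N i \<alpha>" E "\<lambda>k \<omega>. (Dl i k \<omega>, Zl i k \<omega>)" \<nu>
    by (rule compound_poisson_row[OF i \<alpha>])
  have a: "a \<le> T" using i by (auto simp: a_def)
  have eq: "outstanding i \<alpha> = (\<lambda>\<omega>. cp.S (\<lambda>e. w T e - w a e) (N i \<alpha> \<omega>) \<omega>)"
    by (simp add: fun_eq_iff outstanding_def a_def cum_eq_w cp.S_def sum_subtractf)
  have m: "(\<lambda>e. w T e - w a e) \<in> borel_measurable E" by measurable
  note w_diff_nu[OF a]
  then show "expectation (outstanding i \<alpha>) = lam i * \<alpha> * (expectation Z * (1 - p a))"
    "integrable M (\<lambda>\<omega>. (outstanding i \<alpha> \<omega>)\<^sup>2)"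
    "expectation (\<lambda>\<omega>. (outstanding i \<alpha> \<omega>)\<^sup>2) =
      lam i * \<alpha> * (expectation (\<lambda>\<omega>. (Z \<omega>)\<^sup>2) * (1 - p a)) + (lam i * \<alpha> * (expectation Z * (1 - p a)))\<^sup>2"
    unfolding eq using cp.S_expectation[OF m] cp.S_sq_integrable[OF m] cp.S_sq_expectation[OF m]
    by simp_all
qed

text \<open>The error is the outstanding amount minus b V with b = 1 / p a - 1. The mean of the
  outstanding amount is b E[V], so the cross term completes a square and leaves the outstanding
  variance plus b^2 (V - E[V])^2.\<close>

lemma cond_exp_squared_error:
  assumes i: "i \<in> {1..T}" and \<alpha>: "0 < \<alpha>"
  defines "a \<equiv> T - i + 1"
  shows "AE \<omega> in M. real_cond_exp M (triangle_alg M T N Dl Zl \<alpha>)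
      (\<lambda>\<omega>. (cum N Dl Zl i T \<alpha> \<omega> - cum N Dl Zl i a \<alpha> \<omega> * (1 / p a))\<^sup>2 / cum N Dl Zl i a \<alpha> \<omega>) \<omega> =
    \<alpha> / cum N Dl Zl i a \<alpha> \<omega> * (expectation (\<lambda>\<omega>. real (N i \<alpha> \<omega>)) / \<alpha> * expectation (\<lambda>\<omega>. (Z \<omega>)\<^sup>2) * (1 - p a)
      + (cum N Dl Zl i a \<alpha> \<omega> - expectation (cum N Dl Zl i a \<alpha>))\<^sup>2 / \<alpha> * (1 / p a - 1)\<^sup>2)"
proof -
  interpret cp: compound_poisson M "lam i * \<alpha>" "N i \<alpha>" E "\<lambda>k \<omega>. (Dl i k \<omega>, Zl i k \<omega>)" \<nu>
    by (rule compound_poisson_row[OF i \<alpha>])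
  let ?C = "\<lambda>t. cum N Dl Zl i t \<alpha>" and ?b = "1 / p a - 1"
  have a: "1 \<le> a" "a \<le> T" "i + a \<le> T + 1" using i by (auto simp: a_def)
  have pa: "0 < p a" using a p_pos by simp
  have "?C a \<in> borel_measurable (triangle_alg M T N Dl Zl \<alpha>)"
    using i a by (intro cum_meas_triangle_alg) auto
  from cond_exp_quotient[OF subalgebra_triangle_alg[OF \<alpha>] outstanding_indep[OF i \<alpha>] triangle_alg_observed[OF i]
      this outstanding_moments(2)[OF i \<alpha>] cum_moments(2)[OF i \<alpha>], of ?b]
  have "AE \<omega> in M. real_cond_exp M (triangle_alg M T N Dl Zl \<alpha>) (\<lambda>\<omega>. (outstanding i \<alpha> \<omega> - ?b * ?C a \<omega>)\<^sup>2 / ?C a \<omega>) \<omega> =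
    (expectation (\<lambda>\<omega>. (outstanding i \<alpha> \<omega>)\<^sup>2) - 2 * ?b * ?C a \<omega> * expectation (outstanding i \<alpha>) + (?b * ?C a \<omega>)\<^sup>2) / ?C a \<omega>"
    by simp
  moreover have "(outstanding i \<alpha> \<omega> - ?b * ?C a \<omega>)\<^sup>2 = (?C T \<omega> - ?C a \<omega> * (1 / p a))\<^sup>2" for \<omega>
    by (rule arg_cong[where f="\<lambda>x. x\<^sup>2"]) (simp add: outstanding_def a_def algebra_simps)
  moreover have "(expectation (\<lambda>\<omega>. (outstanding i \<alpha> \<omega>)\<^sup>2) - 2 * ?b * ?C a \<omega> * expectation (outstanding i \<alpha>) + (?b * ?C a \<omega>)\<^sup>2) / ?C a \<omega> =
    \<alpha> / ?C a \<omega> * (expectation (\<lambda>\<omega>. real (N i \<alpha> \<omega>)) / \<alpha> * expectation (\<lambda>\<omega>. (Z \<omega>)\<^sup>2) * (1 - p a)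
      + (?C a \<omega> - expectation (?C a))\<^sup>2 / \<alpha> * ?b\<^sup>2)" for \<omega>
  proof -
    define m where "m = lam i * \<alpha> * (expectation Z * p a)"
    have 1: "lam i * \<alpha> * (expectation Z * (1 - p a)) = ?b * m"
      using pa by (simp add: m_def field_simps)
    have 2: "s + (b * m)\<^sup>2 - 2 * b * v * (b * m) + (b * v)\<^sup>2 = s + (v - m)\<^sup>2 * b\<^sup>2" for s b v :: real
      by (simp add: power2_eq_square algebra_simps)
    \<comment> \<open>At v = 0 both sides are 0 by the convention for division.\<close>
    have 3: "(x * e + y) / v = \<alpha> / v * (x / \<alpha> * e + y / \<alpha>)" for x e y v
      using \<alpha> by (cases "v = 0") (simp_all add: field_simps)
    show ?thesis
      unfolding outstanding_moments[OF i \<alpha>, folded a_def] cum_moments(1)[OF i \<alpha>] cp.N_expectation 1 m_def[symmetric] 2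
      using 3[of "lam i * \<alpha>" "expectation (\<lambda>\<omega>. (Z \<omega>)\<^sup>2) * (1 - p a)" "(?C a \<omega> - m)\<^sup>2 * ?b\<^sup>2" "?C a \<omega>"]
      by (simp add: mult.assoc)
  qed
  ultimately show ?thesis by (simp only:)
qed

section \<open>Limits of the statistics as the exposure grows\<close>

lemma standardized_cum_weak_conv:
  assumes i: "i \<in> {1..T}" and t: "1 \<le> t" and X: "\<And>n. 0 < X n" "filterlim X at_top sequentially"
  shows "weak_conv_m (\<lambda>n. distr M borel (\<lambda>\<omega>. (cum N Dl Zl i t (X n) \<omega> - expectation (cum N Dl Zl i t (X n))) /
      sqrt (lam i * X n * (expectation (\<lambda>\<omega>. (Z \<omega>)\<^sup>2) * p t)))) std_normal_distribution"
proof -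
  let ?L = "\<lambda>n. distr M borel (cum N Dl Zl i t (X n))" and ?\<rho> = "distr \<nu> borel (w t)"
  have l: "0 < lam i" using i lam_pos by auto
  interpret nu: prob_space \<nu>
    using compound_poisson.prob_space_nu[OF compound_poisson_row[OF i X(1)]] .
  note [measurable] = cum_meas[OF i X(1), of t]
  have [measurable_cong]: "sets \<nu> = sets E" by (simp add: \<nu>_def)
  have "weak_conv_m (\<lambda>n. distr (?L n) borel (\<lambda>x. (x - lam i * X n * (expectation Z * p t)) /
      sqrt (lam i * X n * (expectation (\<lambda>\<omega>. (Z \<omega>)\<^sup>2) * p t)))) std_normal_distribution"
  proof (rule compound_poisson_clt[where \<rho> = ?\<rho>])
    show "real_distribution (?L n)" for n
      by (rule real_distribution_distr) measurable
    show "real_distribution ?\<rho>"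
      by (rule nu.real_distribution_distr) measurable
    show "integrable ?\<rho> (\<lambda>x. x\<^sup>2)"
      by (subst integrable_distr_eq) (auto simp: w_nu)
    show "(\<integral>x. x \<partial>?\<rho>) = expectation Z * p t"
      by (subst integral_distr) (auto simp: w_nu)
    show "(\<integral>x. x\<^sup>2 \<partial>?\<rho>) = expectation (\<lambda>\<omega>. (Z \<omega>)\<^sup>2) * p t"
      by (subst integral_distr) (auto simp: w_nu)
    show "0 < expectation (\<lambda>\<omega>. (Z \<omega>)\<^sup>2) * p t"
      using EZ2_pos p_pos[OF t] by simp
    show "0 < lam i * X n" for n using l X(1) by simp
    show "filterlim (\<lambda>n. lam i * X n) at_top sequentially"
      by (rule filterlim_tendsto_pos_mult_at_top[OF tendsto_const l X(2)])
    fix n s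
    interpret cp: compound_poisson M "lam i * X n" "N i (X n)" E "\<lambda>k \<omega>. (Dl i k \<omega>, Zl i k \<omega>)" \<nu>
      by (rule compound_poisson_row[OF i X(1)])
    have eq: "cum N Dl Zl i t (X n) = (\<lambda>\<omega>. cp.S (w t) (N i (X n) \<omega>) \<omega>)"
      by (simp add: fun_eq_iff cum_eq_w cp.S_def)
    show "char (?L n) s = exp (of_real (lam i * X n) * (char ?\<rho> s - 1))"
      unfolding eq by (rule cp.char_S) measurable
  qed
  moreover have "distr (?L n) borel (\<lambda>x. (x - lam i * X n * (expectation Z * p t)) / sqrt (lam i * X n * (expectation (\<lambda>\<omega>. (Z \<omega>)\<^sup>2) * p t))) =
    distr M borel (\<lambda>\<omega>. (cum N Dl Zl i t (X n) \<omega> - expectation (cum N Dl Zl i t (X n))) /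
      sqrt (lam i * X n * (expectation (\<lambda>\<omega>. (Z \<omega>)\<^sup>2) * p t)))" for n
    by (subst distr_distr) (auto simp: comp_def cum_moments[OF i X(1)])
  ultimately show ?thesis by simp
qed

text \<open>The common frame for both limits. Equality almost everywhere is the right hypothesis,
  since a conditional expectation is known only up to null sets; \<open>hk\<close> is the continuous
  convergence of maps that depend on \<alpha>.\<close>

lemma conv_distr_standardized:
  fixes h :: "real \<Rightarrow> real \<Rightarrow> real" and k :: "real \<Rightarrow> real"
  assumes i: "i \<in> {1..T}" and t: "1 \<le> t"
    and Y: "\<And>\<alpha>. 0 < \<alpha> \<Longrightarrow> AE \<omega> in M. Y \<alpha> \<omega> = h \<alpha> ((cum N Dl Zl i t \<alpha> \<omega> - expectation (cum N Dl Zl i t \<alpha>)) /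
      sqrt (lam i * \<alpha> * (expectation (\<lambda>\<omega>. (Z \<omega>)\<^sup>2) * p t)))"
    and Ym: "\<And>\<alpha>. 0 < \<alpha> \<Longrightarrow> Y \<alpha> \<in> borel_measurable M"
    and h[measurable]: "\<And>\<alpha>. h \<alpha> \<in> borel_measurable borel" "k \<in> borel_measurable borel"
    and hk: "\<And>x xs X. xs \<longlonglongrightarrow> x \<Longrightarrow> filterlim X at_top sequentially \<Longrightarrow> (\<lambda>n. h (X n) (xs n)) \<longlonglongrightarrow> k x"
  shows "conv_distr_at_top (\<lambda>\<alpha>. distr M borel (Y \<alpha>)) (distr std_normal borel k)"
proof (rule conv_distr_at_topI)
  fix X :: "nat \<Rightarrow> real" assume X: "\<And>n. 0 < X n" "filterlim X at_top sequentially"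
  let ?G = "\<lambda>n \<omega>. (cum N Dl Zl i t (X n) \<omega> - expectation (cum N Dl Zl i t (X n))) /
      sqrt (lam i * X n * (expectation (\<lambda>\<omega>. (Z \<omega>)\<^sup>2) * p t))"
  note [measurable] = cum_meas[OF i X(1), of t] Ym[OF X(1)]
  have "weak_conv_m (\<lambda>n. distr (distr M borel (?G n)) borel (h (X n))) (distr std_normal_distribution borel k)"
  proof (rule weak_conv_m_continuous_family)
    show "real_distribution (distr M borel (?G n))" for n
      by (rule real_distribution_distr) measurable
  qed (use standardized_cum_weak_conv[OF i t X] X(2) real_dist_normal_dist hk in auto)
  moreover have "distr (distr M borel (?G n)) borel (h (X n)) = distr M borel (Y (X n))" for n
  proof -
    have "distr (distr M borel (?G n)) borel (h (X n)) = distr M borel (\<lambda>\<omega>. h (X n) (?G n \<omega>))"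
      by (subst distr_distr) (auto simp: comp_def)
    also have "\<dots> = distr M borel (Y (X n))"
      using Y[OF X(1)[of n]] by (intro distr_cong_AE) auto
    finally show ?thesis .
  qed
  ultimately show "weak_conv_m (\<lambda>n. distr M borel (Y (X n))) (distr std_normal borel k)"
    by (simp add: std_normal_def)
qed

lemma distr_chi2_1:
  assumes [measurable]: "k \<in> borel_measurable borel"
  shows "distr chi2_1 borel k = distr std_normal borel (\<lambda>x. k (x\<^sup>2))"
  unfolding chi2_1_def std_normal_def by (subst distr_distr) (auto simp: comp_def)

lemma conv_squared_deviation:
  assumes i: "i \<in> {1..T}" and t: "1 \<le> t"
  shows "conv_distr_at_top (\<lambda>\<alpha>. distr M borel (\<lambda>\<omega>. (cum N Dl Zl i t \<alpha> \<omega> - expectation (cum N Dl Zl i t \<alpha>))\<^sup>2 / \<alpha>))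
    (distr chi2_1 borel (\<lambda>x. lam i * expectation (\<lambda>\<omega>. (Z \<omega>)\<^sup>2) * p t * x))"
proof -
  let ?s = "expectation (\<lambda>\<omega>. (Z \<omega>)\<^sup>2) * p t"
  have s: "0 < lam i * ?s" using i lam_pos EZ2_pos p_pos[OF t] by auto
  have "conv_distr_at_top (\<lambda>\<alpha>. distr M borel (\<lambda>\<omega>. (cum N Dl Zl i t \<alpha> \<omega> - expectation (cum N Dl Zl i t \<alpha>))\<^sup>2 / \<alpha>))
    (distr std_normal borel (\<lambda>x. lam i * ?s * x\<^sup>2))"
  proof (rule conv_distr_standardized[OF i t, where h="\<lambda>\<alpha> x. lam i * ?s * x\<^sup>2"])
    fix \<alpha> :: real assume \<alpha>: "0 < \<alpha>"
    have "v\<^sup>2 / \<alpha> = lam i * ?s * (v / sqrt (lam i * \<alpha> * ?s))\<^sup>2" for v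
      using sqrt_rescale(1)[OF s \<alpha>, of v] by (simp add: mult.left_commute mult.assoc)
    then show "AE \<omega> in M. (cum N Dl Zl i t \<alpha> \<omega> - expectation (cum N Dl Zl i t \<alpha>))\<^sup>2 / \<alpha> =
        lam i * ?s * ((cum N Dl Zl i t \<alpha> \<omega> - expectation (cum N Dl Zl i t \<alpha>)) / sqrt (lam i * \<alpha> * ?s))\<^sup>2"
      by simp
    note [measurable] = cum_meas[OF i \<alpha>]
    show "(\<lambda>\<omega>. (cum N Dl Zl i t \<alpha> \<omega> - expectation (cum N Dl Zl i t \<alpha>))\<^sup>2 / \<alpha>) \<in> borel_measurable M"
      by measurable
  qed (auto intro!: tendsto_intros)
  then show ?thesis
    by (subst distr_chi2_1) (auto simp: mult.assoc)
qed

lemma conv_quotient: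
  assumes i: "i \<in> {1..T}" and t: "1 \<le> t"
    and Y: "\<And>\<alpha>. 0 < \<alpha> \<Longrightarrow> AE \<omega> in M. Y \<alpha> \<omega> = \<alpha> / cum N Dl Zl i t \<alpha> \<omega> *
      (A + (cum N Dl Zl i t \<alpha> \<omega> - expectation (cum N Dl Zl i t \<alpha>))\<^sup>2 / \<alpha> * B)"
    and Ym: "\<And>\<alpha>. 0 < \<alpha> \<Longrightarrow> Y \<alpha> \<in> borel_measurable M"
  shows "conv_distr_at_top (\<lambda>\<alpha>. distr M borel (Y \<alpha>))
    (distr chi2_1 borel (\<lambda>x. (A + lam i * expectation (\<lambda>\<omega>. (Z \<omega>)\<^sup>2) * p t * x * B) / (lam i * expectation Z * p t)))"
proof -
  let ?s = "expectation (\<lambda>\<omega>. (Z \<omega>)\<^sup>2) * p t" and ?m = "lam i * expectation Z * p t"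
  \<comment> \<open>The denominator is V / \<alpha> in terms of the standardized deviation x: its
    mean \<open>?m\<close> plus a fluctuation of order \<alpha>^(-1/2). For each \<alpha> there is a
    pole at a negative x of order sqrt \<alpha>.\<close>
  let ?h = "\<lambda>\<alpha> x. (A + lam i * ?s * x\<^sup>2 * B) / (?m + sqrt (lam i * ?s) * x / sqrt \<alpha>)"
  have s: "0 < lam i * ?s" using i lam_pos EZ2_pos p_pos[OF t] by auto
  have m: "0 < ?m" using i lam_pos EZ_pos p_pos[OF t] by auto
  have "conv_distr_at_top (\<lambda>\<alpha>. distr M borel (Y \<alpha>))
    (distr std_normal borel (\<lambda>x. (A + lam i * ?s * x\<^sup>2 * B) / ?m))"
  proof (rule conv_distr_standardized[OF i t _ Ym, where h = ?h])
    fix \<alpha> :: real assume \<alpha>: "0 < \<alpha>"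
    have eq: "\<alpha> / v * (A + (v - lam i * \<alpha> * (expectation Z * p t))\<^sup>2 / \<alpha> * B) = ?h \<alpha> ((v - lam i * \<alpha> * (expectation Z * p t)) / sqrt (lam i * \<alpha> * ?s))" for v
    proof -
      let ?d = "v - lam i * \<alpha> * (expectation Z * p t)"
      have c: "lam i * \<alpha> * ?s = \<alpha> * (lam i * ?s)" by (simp only: mult_ac)
      have "?d / \<alpha> = v / \<alpha> - ?m" using \<alpha> by (simp add: field_simps)
      then have 2: "?m + sqrt (lam i * ?s) * (?d / sqrt (lam i * \<alpha> * ?s)) / sqrt \<alpha> = v / \<alpha>"
        unfolding c sqrt_rescale(2)[OF s \<alpha>] by simp
      have 1: "lam i * ?s * (?d / sqrt (lam i * \<alpha> * ?s))\<^sup>2 = ?d\<^sup>2 / \<alpha>"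
        unfolding c sqrt_rescale(1)[OF s \<alpha>] ..
      show ?thesis unfolding 1 2 by simp
    qed
    show "AE \<omega> in M. Y \<alpha> \<omega> = ?h \<alpha> ((cum N Dl Zl i t \<alpha> \<omega> - expectation (cum N Dl Zl i t \<alpha>)) / sqrt (lam i * \<alpha> * ?s))"
      using Y[OF \<alpha>] unfolding cum_moments(1)[OF i \<alpha>] eq .
  next
    fix x :: real and xs X :: "nat \<Rightarrow> real"
    assume xs: "xs \<longlonglongrightarrow> x" and X: "filterlim X at_top sequentially"
    have "(\<lambda>n. sqrt (lam i * ?s) * xs n / sqrt (X n)) \<longlonglongrightarrow> 0"
      by (intro tendsto_divide_0[OF tendsto_mult[OF tendsto_const xs]] filterlim_at_top_imp_at_infinity
          filterlim_compose[OF sqrt_at_top X])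
    \<comment> \<open>Along a convergent sequence the fluctuation dies out, and positivity of
      \<open>?m\<close> keeps the limiting denominator away from the pole.\<close>
    then have "(\<lambda>n. ?h (X n) (xs n)) \<longlonglongrightarrow> (A + lam i * ?s * x\<^sup>2 * B) / (?m + 0)"
      using m by (intro tendsto_intros xs) auto
    then show "(\<lambda>n. ?h (X n) (xs n)) \<longlonglongrightarrow> (A + lam i * ?s * x\<^sup>2 * B) / ?m" by simp
  qed auto
  then show ?thesis
    by (subst distr_chi2_1) (auto simp: mult.assoc)
qed

end

section \<open>Conditional prediction error of a row and its limit\<close>

theorem theorem3:
  fixes M :: "'a measure" and T :: nat and lam :: "nat \<Rightarrow> real"
    and N :: "nat \<Rightarrow> real \<Rightarrow> 'a \<Rightarrow> nat"
    and Dl :: "nat \<Rightarrow> nat \<Rightarrow> 'a \<Rightarrow> nat" and Zl :: "nat \<Rightarrow> nat \<Rightarrow> 'a \<Rightarrow> real"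
    and D :: "'a \<Rightarrow> nat" and Z :: "'a \<Rightarrow> real"
  assumes M: "prob_space M"
    and T: "T \<ge> 2"
    and lam_pos: "\<forall>i\<in>{1..T}. 0 < lam i"
    and pois: "\<forall>i\<in>{1..T}. poisson_process M (N i) (lam i)"
    and D_meas: "D \<in> measurable M (count_space UNIV)"
    and Z_meas: "Z \<in> borel_measurable M"
    and D_range: "\<forall>\<omega>\<in>space M. D \<omega> \<in> {1..T}"
    and DZ_indep: "prob_space.indep_var M borel (\<lambda>\<omega>. real (D \<omega>)) borel Z"
    and Z2_int: "integrable M (\<lambda>\<omega>. (Z \<omega>)\<^sup>2)"
    and EZD_pos: "\<forall>t\<in>{1..T}. 0 < (LINT \<omega>|M. Z \<omega> * indicator {\<omega>. D \<omega> = t} \<omega>)"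
    and pairs_meas: "\<forall>i\<in>{1..T}. \<forall>k\<ge>1.
        (\<lambda>\<omega>. (Dl i k \<omega>, Zl i k \<omega>)) \<in> measurable M (count_space UNIV \<Otimes>\<^sub>M borel)"
    and pairs_distr: "\<forall>i\<in>{1..T}. \<forall>k\<ge>1.
        distr M (count_space UNIV \<Otimes>\<^sub>M borel) (\<lambda>\<omega>. (Dl i k \<omega>, Zl i k \<omega>))
          = distr M (count_space UNIV \<Otimes>\<^sub>M borel) (\<lambda>\<omega>. (D \<omega>, Z \<omega>))"
    and indep: "prob_space.indep_sets M
        (\<lambda>(i, ko). case ko of
            None \<Rightarrow> gen_sets M (count_space UNIV) {N i a | a. 0 \<le> a}
          | Some k \<Rightarrow> gen_sets M (count_space UNIV \<Otimes>\<^sub>M borel) {\<lambda>\<omega>. (Dl i k \<omega>, Zl i k \<omega>)})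
        ({1..T} \<times> (insert None (Some ` {1..})))"
  shows "\<forall>i\<in>{2..T}.
    let a = T - i + 1;
        f = dev_f M D Z;
        g = (\<Prod>s\<in>{a..<T}. f s);
        C = cum N Dl Zl i;
        EZ = (LINT \<omega>|M. Z \<omega>);
        EZ2 = (LINT \<omega>|M. (Z \<omega>)\<^sup>2);
        PDgt = measure M {\<omega>\<in>space M. a < D \<omega>};
        PDle = measure M {\<omega>\<in>space M. D \<omega> \<le> a};
        H2 = (\<lambda>\<alpha> \<omega>. (C a \<alpha> \<omega> - (LINT \<omega>'|M. C a \<alpha> \<omega>'))\<^sup>2 / \<alpha>);
        CE = (\<lambda>\<alpha>. real_cond_exp M (triangle_alg M T N Dl Zl \<alpha>)
                    (\<lambda>\<omega>. (C T \<alpha> \<omega> - C a \<alpha> \<omega> * g)\<^sup>2 / C a \<alpha> \<omega>));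
        Lim = distr chi2_1 borel (\<lambda>x. EZ2 / EZ * ((g - 1) + (g - 1)\<^sup>2 * x));
        LimH = distr chi2_1 borel (\<lambda>x. lam i * EZ2 * PDle * x)
    in (\<forall>\<alpha>>0. AE \<omega> in M.
          CE \<alpha> \<omega> = \<alpha> / C a \<alpha> \<omega> *
            ((LINT \<omega>'|M. real (N i \<alpha> \<omega>')) / \<alpha> * EZ2 * PDgt + H2 \<alpha> \<omega> * (g - 1)\<^sup>2))
     \<and> conv_distr_at_top (\<lambda>\<alpha>. distr M borel (CE \<alpha>)) Lim
     \<and> conv_distr_at_top (\<lambda>\<alpha>. distr M borel (H2 \<alpha>)) LimH
     \<and> (\<integral>x. x \<partial>Lim) = (lam i * EZ2 * PDgt + (\<integral>x. x \<partial>LimH) * (g - 1)\<^sup>2) / (lam i * EZ * PDle)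
     \<and> (lam i * EZ2 * PDgt + (\<integral>x. x \<partial>LimH) * (g - 1)\<^sup>2) / (lam i * EZ * PDle)
         = (\<Sum>t\<in>{a..<T}. (\<Prod>s\<in>{a..<t}. f s) * dev_sigma2 M D Z t * (\<Prod>s\<in>{Suc t..<T}. (f s)\<^sup>2))"
proof
  fix i assume "i \<in> {2..T}"
  then have i: "i \<in> {1..T}" by simp
  interpret prob_space M by (rule M)
  interpret poisson_triangle M T lam N Dl Zl D Z
    by unfold_locales (rule T lam_pos pois D_meas Z_meas D_range DZ_indep Z2_int EZD_pos pairs_meas pairs_distr indep)+
  define a where "a = T - i + 1"
  have a: "1 \<le> a" "a \<le> T" using i by (auto simp: a_def)
  let ?EZ = "expectation Z" and ?EZ2 = "expectation (\<lambda>\<omega>. (Z \<omega>)\<^sup>2)"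
  have pa: "0 < p a" and l: "0 < lam i" using p_pos a i lam_pos by auto
  let ?g = "1 / p a"
  let ?C = "cum N Dl Zl i"
  let ?CE = "\<lambda>\<alpha>. real_cond_exp M (triangle_alg M T N Dl Zl \<alpha>) (\<lambda>\<omega>. (?C T \<alpha> \<omega> - ?C a \<alpha> \<omega> * ?g)\<^sup>2 / ?C a \<alpha> \<omega>)"
  let ?Lim = "distr chi2_1 borel (\<lambda>x. ?EZ2 / ?EZ * ((?g - 1) + (?g - 1)\<^sup>2 * x))"
  let ?LimH = "distr chi2_1 borel (\<lambda>x. lam i * ?EZ2 * p a * x)"
  have CE: "\<forall>\<alpha>>0. AE \<omega> in M. ?CE \<alpha> \<omega> = \<alpha> / ?C a \<alpha> \<omega> *
      (expectation (\<lambda>\<omega>. real (N i \<alpha> \<omega>)) / \<alpha> * ?EZ2 * (1 - p a) + (?C a \<alpha> \<omega> - expectation (?C a \<alpha>))\<^sup>2 / \<alpha> * (?g - 1)\<^sup>2)"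
    using cond_exp_squared_error[OF i] by (simp add: a_def)
  \<comment> \<open>The mean count per unit of \<alpha> does not depend on \<alpha>, so the first
    summand is the fixed number \<open>A\<close> of \<open>conv_quotient\<close>.\<close>
  have EN: "expectation (\<lambda>\<omega>. real (N i \<alpha> \<omega>)) / \<alpha> = lam i" if "0 < \<alpha>" for \<alpha>
    using compound_poisson.N_expectation[OF compound_poisson_row[OF i that]] that by simp
  have "conv_distr_at_top (\<lambda>\<alpha>. distr M borel (?CE \<alpha>))
      (distr chi2_1 borel (\<lambda>x. (lam i * ?EZ2 * (1 - p a) + lam i * ?EZ2 * p a * x * (?g - 1)\<^sup>2) / (lam i * ?EZ * p a)))"
  proof (rule conv_quotient[OF i a(1)])
    fix \<alpha> :: real assume \<alpha>: "0 < \<alpha>"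
    show "AE \<omega> in M. ?CE \<alpha> \<omega> = \<alpha> / ?C a \<alpha> \<omega> * (lam i * ?EZ2 * (1 - p a) + (?C a \<alpha> \<omega> - expectation (?C a \<alpha>))\<^sup>2 / \<alpha> * (?g - 1)\<^sup>2)"
      using CE[rule_format, OF \<alpha>] unfolding EN[OF \<alpha>] .
  qed simp
  \<comment> \<open>With g = 1 / p a the quotient (1 - p a) / p a is g - 1, which brings the raw
    limit into the stated form.\<close>
  moreover have "(lam i * ?EZ2 * (1 - p a) + lam i * ?EZ2 * p a * x * (?g - 1)\<^sup>2) / (lam i * ?EZ * p a) =
      ?EZ2 / ?EZ * ((?g - 1) + (?g - 1)\<^sup>2 * x)" for x
  proof -
    have "(l * e * (1 - q) + l * e * q * x * b) / (l * z * q) = e / z * ((1 / q - 1) + b * x)"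
      if "l > 0" "z > 0" "q > 0" for l e q b z :: real
      using that by (simp add: field_simps)
    then show ?thesis using l EZ_pos pa by blast
  qed
  ultimately have conv: "conv_distr_at_top (\<lambda>\<alpha>. distr M borel (?CE \<alpha>)) ?Lim"
    by simp
  interpret chi: prob_space chi2_1 by (rule prob_space_chi2_1)
  have [measurable_cong]: "sets chi2_1 = sets borel" by (simp add: chi2_1_def)
  have ELim: "(\<integral>x. x \<partial>?Lim) = ?EZ2 / ?EZ * ((?g - 1) + (?g - 1)\<^sup>2)"
    by (subst integral_distr)
       (auto simp: integrable_chi2_1 expectation_chi2_1 chi.prob_space[simplified])
  have ELimH: "(\<integral>x. x \<partial>?LimH) = lam i * ?EZ2 * p a"
    by (subst integral_distr) (auto simp: expectation_chi2_1)
  have frac: "(lam i * ?EZ2 * (1 - p a) + (\<integral>x. x \<partial>?LimH) * (?g - 1)\<^sup>2) / (lam i * ?EZ * p a) = ?EZ2 / ?EZ * ((?g - 1) + (?g - 1)\<^sup>2)"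
  proof -
    have "(l * e * (1 - q) + l * e * q * b) / (l * z * q) = e / z * ((1 / q - 1) + b)"
      if "l > 0" "z > 0" "q > 0" for l e q b z :: real
      using that by (simp add: field_simps)
    then show ?thesis unfolding ELimH using l EZ_pos pa by blast
  qed
  show "let a = T - i + 1;
        f = dev_f M D Z;
        g = (\<Prod>s\<in>{a..<T}. f s);
        C = cum N Dl Zl i;
        EZ = (LINT \<omega>|M. Z \<omega>);
        EZ2 = (LINT \<omega>|M. (Z \<omega>)\<^sup>2);
        PDgt = measure M {\<omega>\<in>space M. a < D \<omega>};
        PDle = measure M {\<omega>\<in>space M. D \<omega> \<le> a};
        H2 = (\<lambda>\<alpha> \<omega>. (C a \<alpha> \<omega> - (LINT \<omega>'|M. C a \<alpha> \<omega>'))\<^sup>2 / \<alpha>);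
        CE = (\<lambda>\<alpha>. real_cond_exp M (triangle_alg M T N Dl Zl \<alpha>)
                    (\<lambda>\<omega>. (C T \<alpha> \<omega> - C a \<alpha> \<omega> * g)\<^sup>2 / C a \<alpha> \<omega>));
        Lim = distr chi2_1 borel (\<lambda>x. EZ2 / EZ * ((g - 1) + (g - 1)\<^sup>2 * x));
        LimH = distr chi2_1 borel (\<lambda>x. lam i * EZ2 * PDle * x)
    in (\<forall>\<alpha>>0. AE \<omega> in M.
          CE \<alpha> \<omega> = \<alpha> / C a \<alpha> \<omega> *
            ((LINT \<omega>'|M. real (N i \<alpha> \<omega>')) / \<alpha> * EZ2 * PDgt + H2 \<alpha> \<omega> * (g - 1)\<^sup>2))
     \<and> conv_distr_at_top (\<lambda>\<alpha>. distr M borel (CE \<alpha>)) Lim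
     \<and> conv_distr_at_top (\<lambda>\<alpha>. distr M borel (H2 \<alpha>)) LimH
     \<and> (\<integral>x. x \<partial>Lim) = (lam i * EZ2 * PDgt + (\<integral>x. x \<partial>LimH) * (g - 1)\<^sup>2) / (lam i * EZ * PDle)
     \<and> (lam i * EZ2 * PDgt + (\<integral>x. x \<partial>LimH) * (g - 1)\<^sup>2) / (lam i * EZ * PDle)
         = (\<Sum>t\<in>{a..<T}. (\<Prod>s\<in>{a..<t}. f s) * dev_sigma2 M D Z t * (\<Prod>s\<in>{Suc t..<T}. (f s)\<^sup>2))"
    \<comment> \<open>All development factors and both delay probabilities become expressions in
      \<open>p a\<close>, the form of the facts collected above.\<close>
    unfolding Let_def a_def[symmetric] dev_prod[OF a] prob_D_gr p_def[of a, symmetric]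
    using CE conv conv_squared_deviation[OF i a(1)] ELim frac dev_sum[OF a] by simp
qed

end
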